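(* Let $A$ be an ordinary (ungraded) ring and let $d\in\{1,2,\ldots\}\cup\{\infty\}$. Let $\rho$ be a normalized $d$-periodic rank function on $\operatorname{Perf}(A)$. Then the restriction of $\rho$ to morphisms of $\operatorname{proj}(A)$ (regarded as a full subcategory of $\operatorname{Perf}(A)$ via complexes concentrated in degree $0$) takes values in $\mathbb{R}_{\geq 0}$ and is a Sylvester morphism rank function on $A$. In the case $d=\infty$, this restriction determines a bijection between normalized $\infty$-periodic rank functions on $\operatorname{Perf}(A)$ and Sylvester morphism rank functions on $A$.
   Context: $\operatorname{Perf}(A)$ is the perfect derived category of (right) $A$-modules, a triangulated category with translation functor $\Sigma$; $\operatorname{proj}(A)$ is the category of finitely generated projective right $A$-modules. For $d\in\{1,2,\ldots\}\cup\{\infty\}$ let $\mathbb{R}(d)=\mathbb{R}[q,q^{-1}]$ if $d=\infty$ and $\mathbb{R}(d)=\mathbb{R}[q]/(q^d-1)$ if $d<\infty$; let $\mathbb{R}_{\geq0}(d)$ be the set of elements represented by (Laurent) polynomials with nonnegative coefficients; write $\phi\geq\psi$ if $\phi-\psi\in\mathbb{R}_{\geq0}(d)$. Real numbers are regarded as constants in $\mathbb{R}(d)$. A $d$-periodic rank function on a triangulated category $\mathcal{C}$ assigns to each morphism $f$ an element $\rho(f)\in\mathbb{R}_{\geq0}(d)$ such that: (i) $\rho(\Sigma f)=q\rho(f)$; (ii) $\rho(f\oplus g)=\rho(f)+\rho(g)$; (iii) for every exact triangle $X\xrightarrow{f}Y\xrightarrow{g}Z\rightsquigarrow$, $\rho(f)+\rho(g)=\rho(\mathrm{id}_Y)$;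 (iv) for morphisms $f:X\to Y$, $g:Z\to W$, $h:Z\to Y$, the morphism $\begin{pmatrix} f&h\\0&g\end{pmatrix}:X\oplus Z\to Y\oplus W$ has rank $\geq\rho(f)+\rho(g)$; (v) $\rho(gf)\leq\rho(f)$ and $\rho(gf)\leq\rho(g)$ whenever $gf$ is defined. One writes $\rho(X)=\rho(\mathrm{id}_X)$; $\rho$ is normalized if $\rho(A)=1$. A Sylvester morphism rank function on $A$ assigns to each morphism $f$ of $\operatorname{proj}(A)$ a real number $\rho(f)\geq 0$ such that: $\rho(\mathrm{id}_A)=1$; $\rho(f\oplus g)=\rho(f)+\rho(g)$; $\rho\begin{pmatrix} f&h\\0&g\end{pmatrix}\geq\rho(f)+\rho(g)$ whenever defined (with $g,h$ sharing domain and $f,h$ sharing codomain); and $\rho(gf)\leq\rho(f)$, $\rho(gf)\leq\rho(g)$ whenever $gf$ is defined. *)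

theory Defs
  imports "Jordan_Normal_Form.Matrix" "HOL-Library.Extended_Nat"
begin

section \<open>The coefficient ring R(d) = R[q,q^-1] (d = infinity) or R[q]/(q^d - 1)\<close>

text \<open>An element of R(d) is represented by its coefficient function on the integers:
  for d = infinity a finitely supported function (Laurent polynomial), for finite d a
  d-periodic function (coefficient of q^n is phi (n mod d)).\<close>

definition Rd :: "enat \<Rightarrow> (int \<Rightarrow> real) \<Rightarrow> bool" where
  "Rd d phi \<longleftrightarrow>
     (d = \<infinity> \<longrightarrow> finite {n. phi n \<noteq> 0}) \<and>
     (\<forall>k. d = enat k \<longrightarrow> (\<forall>n. phi (n + int k) = phi n))"

definition Rpos :: "enat \<Rightarrow> (int \<Rightarrow> real) \<Rightarrow> bool" where
  "Rpos d phi \<longleftrightarrow> Rd d phi \<and> (\<forall>n. 0 \<le> phi n)"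

definition Rle :: "enat \<Rightarrow> (int \<Rightarrow> real) \<Rightarrow> (int \<Rightarrow> real) \<Rightarrow> bool" where
  "Rle d psi phi \<longleftrightarrow> Rpos d (\<lambda>n. phi n - psi n)"

definition Radd :: "(int \<Rightarrow> real) \<Rightarrow> (int \<Rightarrow> real) \<Rightarrow> int \<Rightarrow> real" where
  "Radd phi psi = (\<lambda>n. phi n + psi n)"

definition qmul :: "(int \<Rightarrow> real) \<Rightarrow> int \<Rightarrow> real" where
  "qmul phi = (\<lambda>n. phi (n - 1))"

definition rconst :: "enat \<Rightarrow> real \<Rightarrow> int \<Rightarrow> real" where
  "rconst d c = (\<lambda>n. case d of enat k \<Rightarrow> (if int k dvd n then c else 0)
                              | \<infinity> \<Rightarrow> (if n = 0 then c else 0))"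

section \<open>proj(A): idempotent-matrix model (right modules, maps = left multiplication)\<close>

text \<open>An object is a square idempotent matrix e (the module e A^n); a morphism e \<rightarrow> e'
  is a matrix f with e' f e = f.\<close>

definition pobj :: "'a::ring_1 mat \<Rightarrow> bool" where
  "pobj e \<longleftrightarrow> e \<in> carrier_mat (dim_row e) (dim_row e) \<and> e * e = e"

definition pmor :: "'a::ring_1 mat \<Rightarrow> 'a mat \<Rightarrow> 'a mat \<Rightarrow> bool" where
  "pmor e e' f \<longleftrightarrow> f \<in> carrier_mat (dim_row e') (dim_row e) \<and> e' * f * e = f"

definition bdiag :: "'a::ring_1 mat \<Rightarrow> 'a mat \<Rightarrow> 'a mat" where
  "bdiag A B = four_block_mat A (0\<^sub>m (dim_row A) (dim_col B)) (0\<^sub>m (dim_row B) (dim_col A)) B"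

definition utri :: "'a::ring_1 mat \<Rightarrow> 'a mat \<Rightarrow> 'a mat \<Rightarrow> 'a mat" where
  "utri f h g = four_block_mat f h (0\<^sub>m (dim_row g) (dim_col f)) g"

section \<open>Perf(A) modelled as K^b(proj A)\<close>

text \<open>A complex: objects (idempotents) in each degree and differentials
  d^i : X^i \<rightarrow> X^(i+1) (cohomological indexing).\<close>
type_synonym 'a cx = "(int \<Rightarrow> 'a mat) \<times> (int \<Rightarrow> 'a mat)"

definition cx :: "'a::ring_1 cx \<Rightarrow> bool" where
  "cx X \<longleftrightarrow>
     (\<forall>i. pobj (fst X i)) \<and>
     (\<forall>i. pmor (fst X i) (fst X (i + 1)) (snd X i)) \<and>
     (\<forall>i. snd X (i + 1) * snd X i = 0\<^sub>m (dim_row (fst X (i + 2))) (dim_row (fst X i))) \<and>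
     finite {i. dim_row (fst X i) \<noteq> 0}"

definition chm :: "'a::ring_1 cx \<Rightarrow> 'a cx \<Rightarrow> (int \<Rightarrow> 'a mat) \<Rightarrow> bool" where
  "chm X Y f \<longleftrightarrow>
     (\<forall>i. pmor (fst X i) (fst Y i) (f i)) \<and>
     (\<forall>i. snd Y i * f i = f (i + 1) * snd X i)"

definition htp :: "'a::ring_1 cx \<Rightarrow> 'a cx \<Rightarrow> (int \<Rightarrow> 'a mat) \<Rightarrow> (int \<Rightarrow> 'a mat) \<Rightarrow> bool" where
  "htp X Y f g \<longleftrightarrow>
     (\<exists>h. (\<forall>i. pmor (fst X i) (fst Y (i - 1)) (h i)) \<and>
          (\<forall>i. f i - g i = snd Y (i - 1) * h i + h (i + 1) * snd X i))"

definition comp :: "(int \<Rightarrow> 'a::ring_1 mat) \<Rightarrow> (int \<Rightarrow> 'a mat) \<Rightarrow> int \<Rightarrow> 'a mat" where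
  "comp g f = (\<lambda>i. g i * f i)"

definition idc :: "'a::ring_1 cx \<Rightarrow> int \<Rightarrow> 'a mat" where
  "idc X = fst X"

definition kiso :: "'a::ring_1 cx \<Rightarrow> 'a cx \<Rightarrow> (int \<Rightarrow> 'a mat) \<Rightarrow> bool" where
  "kiso X Y f \<longleftrightarrow> chm X Y f \<and>
     (\<exists>g. chm Y X g \<and> htp X X (comp g f) (idc X) \<and> htp Y Y (comp f g) (idc Y))"

definition shiftc :: "'a::ring_1 cx \<Rightarrow> 'a cx" where
  "shiftc X = (\<lambda>i. fst X (i + 1), \<lambda>i. - snd X (i + 1))"

definition shiftm :: "(int \<Rightarrow> 'a::ring_1 mat) \<Rightarrow> int \<Rightarrow> 'a mat" where
  "shiftm f = (\<lambda>i. f (i + 1))"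

definition dsum :: "'a::ring_1 cx \<Rightarrow> 'a cx \<Rightarrow> 'a cx" where
  "dsum X Y = (\<lambda>i. bdiag (fst X i) (fst Y i), \<lambda>i. bdiag (snd X i) (snd Y i))"

definition msum :: "(int \<Rightarrow> 'a::ring_1 mat) \<Rightarrow> (int \<Rightarrow> 'a mat) \<Rightarrow> int \<Rightarrow> 'a mat" where
  "msum f g = (\<lambda>i. bdiag (f i) (g i))"

definition mutri :: "(int \<Rightarrow> 'a::ring_1 mat) \<Rightarrow> (int \<Rightarrow> 'a mat) \<Rightarrow> (int \<Rightarrow> 'a mat) \<Rightarrow> int \<Rightarrow> 'a mat" where
  "mutri f h g = (\<lambda>i. utri (f i) (h i) (g i))"

definition cone :: "'a::ring_1 cx \<Rightarrow> 'a cx \<Rightarrow> (int \<Rightarrow> 'a mat) \<Rightarrow> 'a cx" where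
  "cone X Y f =
    (\<lambda>i. bdiag (fst X (i + 1)) (fst Y i),
     \<lambda>i. four_block_mat (- snd X (i + 1)) (0\<^sub>m (dim_row (fst X (i + 2))) (dim_row (fst Y i)))
                        (f (i + 1)) (snd Y i))"

definition cinc :: "'a::ring_1 cx \<Rightarrow> 'a cx \<Rightarrow> int \<Rightarrow> 'a mat" where
  "cinc X Y = (\<lambda>i. four_block_mat (0\<^sub>m (dim_row (fst X (i + 1))) (dim_row (fst Y i)))
                                  (0\<^sub>m (dim_row (fst X (i + 1))) 0)
                                  (fst Y i) (0\<^sub>m (dim_row (fst Y i)) 0))"

definition cproj :: "'a::ring_1 cx \<Rightarrow> 'a cx \<Rightarrow> int \<Rightarrow> 'a mat" where
  "cproj X Y = (\<lambda>i. four_block_mat (fst X (i + 1)) (0\<^sub>m (dim_row (fst X (i + 1))) (dim_row (fst Y i)))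
                                   (0\<^sub>m 0 (dim_row (fst X (i + 1)))) (0\<^sub>m 0 (dim_row (fst Y i))))"

definition dtri :: "'a::ring_1 cx \<Rightarrow> 'a cx \<Rightarrow> 'a cx \<Rightarrow>
    (int \<Rightarrow> 'a mat) \<Rightarrow> (int \<Rightarrow> 'a mat) \<Rightarrow> (int \<Rightarrow> 'a mat) \<Rightarrow> bool" where
  "dtri X Y Z f g h \<longleftrightarrow>
     cx X \<and> cx Y \<and> cx Z \<and> chm X Y f \<and> chm Y Z g \<and> chm Z (shiftc X) h \<and>
     (\<exists>X' Y' f' a b c. cx X' \<and> cx Y' \<and> chm X' Y' f' \<and>
        kiso X X' a \<and> kiso Y Y' b \<and> kiso Z (cone X' Y' f') c \<and>
        htp X Y' (comp b f) (comp f' a) \<and>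
        htp Y (cone X' Y' f') (comp c g) (comp (cinc X' Y') b) \<and>
        htp Z (shiftc X') (comp (shiftm a) h) (comp (cproj X' Y') c))"

definition conc0 :: "'a::ring_1 mat \<Rightarrow> 'a cx" where
  "conc0 e = (\<lambda>i. if i = 0 then e else 0\<^sub>m 0 0,
              \<lambda>i. 0\<^sub>m (if i = -1 then dim_row e else 0) (if i = 0 then dim_row e else 0))"

definition conc0m :: "'a::ring_1 mat \<Rightarrow> int \<Rightarrow> 'a mat" where
  "conc0m f = (\<lambda>i. if i = 0 then f else 0\<^sub>m 0 0)"

text \<open>A d-periodic rank function on K^b(proj A): defined on morphisms, i.e. on triples
  (source, target, chain map), and constant on homotopy classes.\<close>
definition rank_fn :: "enat \<Rightarrow> ('a::ring_1 cx \<Rightarrow> 'a cx \<Rightarrow> (int \<Rightarrow> 'a mat) \<Rightarrow> int \<Rightarrow> real) \<Rightarrow> bool" where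
  "rank_fn d rho \<longleftrightarrow>
    (\<forall>X Y f. cx X \<and> cx Y \<and> chm X Y f \<longrightarrow> Rpos d (rho X Y f)) \<and>
    (\<forall>X Y f g. cx X \<and> cx Y \<and> chm X Y f \<and> chm X Y g \<and> htp X Y f g \<longrightarrow> rho X Y f = rho X Y g) \<and>
    (\<forall>X Y f. cx X \<and> cx Y \<and> chm X Y f \<longrightarrow>
        rho (shiftc X) (shiftc Y) (shiftm f) = qmul (rho X Y f)) \<and>
    (\<forall>X Y Z W f g. cx X \<and> cx Y \<and> cx Z \<and> cx W \<and> chm X Y f \<and> chm Z W g \<longrightarrow>
        rho (dsum X Z) (dsum Y W) (msum f g) = Radd (rho X Y f) (rho Z W g)) \<and>
    (\<forall>X Y Z f g h. dtri X Y Z f g h \<longrightarrow>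
        Radd (rho X Y f) (rho Y Z g) = rho Y Y (idc Y)) \<and>
    (\<forall>X Y Z W f g h. cx X \<and> cx Y \<and> cx Z \<and> cx W \<and> chm X Y f \<and> chm Z W g \<and> chm Z Y h \<longrightarrow>
        Rle d (Radd (rho X Y f) (rho Z W g)) (rho (dsum X Z) (dsum Y W) (mutri f h g))) \<and>
    (\<forall>X Y Z f g. cx X \<and> cx Y \<and> cx Z \<and> chm X Y f \<and> chm Y Z g \<longrightarrow>
        Rle d (rho X Z (comp g f)) (rho X Y f) \<and> Rle d (rho X Z (comp g f)) (rho Y Z g))"

definition normalized :: "enat \<Rightarrow> ('a::ring_1 cx \<Rightarrow> 'a cx \<Rightarrow> (int \<Rightarrow> 'a mat) \<Rightarrow> int \<Rightarrow> real) \<Rightarrow> bool" where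
  "normalized d rho \<longleftrightarrow>
     rho (conc0 (1\<^sub>m 1)) (conc0 (1\<^sub>m 1)) (idc (conc0 (1\<^sub>m 1))) = rconst d 1"

definition sylvester :: "('a::ring_1 mat \<Rightarrow> 'a mat \<Rightarrow> 'a mat \<Rightarrow> real) \<Rightarrow> bool" where
  "sylvester s \<longleftrightarrow>
    (\<forall>e e' f. pobj e \<and> pobj e' \<and> pmor e e' f \<longrightarrow> 0 \<le> s e e' f) \<and>
    s (1\<^sub>m 1) (1\<^sub>m 1) (1\<^sub>m 1) = 1 \<and>
    (\<forall>e1 e2 e3 e4 f g. pobj e1 \<and> pobj e2 \<and> pobj e3 \<and> pobj e4 \<and> pmor e1 e2 f \<and> pmor e3 e4 g \<longrightarrow>
        s (bdiag e1 e3) (bdiag e2 e4) (bdiag f g) = s e1 e2 f + s e3 e4 g) \<and>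
    (\<forall>e1 e2 e3 e4 f g h. pobj e1 \<and> pobj e2 \<and> pobj e3 \<and> pobj e4 \<and>
        pmor e1 e2 f \<and> pmor e3 e4 g \<and> pmor e3 e2 h \<longrightarrow>
        s e1 e2 f + s e3 e4 g \<le> s (bdiag e1 e3) (bdiag e2 e4) (utri f h g)) \<and>
    (\<forall>e1 e2 e3 f g. pobj e1 \<and> pobj e2 \<and> pobj e3 \<and> pmor e1 e2 f \<and> pmor e2 e3 g \<longrightarrow>
        s e1 e3 (g * f) \<le> s e1 e2 f \<and> s e1 e3 (g * f) \<le> s e2 e3 g)"

end

theory Submission
  imports Defs
begin

text \<open>Over a field, the rank of the map induced by a chain map \<open>f\<close> on \<open>H\<^sup>i\<close> is the rank of the
  block matrix with rows \<open>(d, 0)\<close> and \<open>(f\<^sup>i, d')\<close> minus the ranks of \<open>d = d\<^sub>X\<^sup>i\<close> and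
  \<open>d' = d\<^sub>Y\<^sup>i\<^sup>-\<^sup>1\<close>.  Read with a Sylvester rank function, this formula defines the extension to chain maps,
  and every axiom becomes an inequality between ranks of block matrices that follows from the
  triangular axiom and from block row and column operations.

  For uniqueness, rotating \<open>X \<rightarrow> Y \<rightarrow> C\<close> with \<open>C\<close> the cone of \<open>f\<close> gives
  \<open>(1 + q) \<rho>(f) = \<rho>(Y) + q \<rho>(X) - \<rho>(C)\<close>, and \<open>1 + q\<close> is not a zero divisor, so the ranks of objects
  suffice. A complex is built by successively attaching its lowest term; the rank of
  an attaching map is concentrated in one degree, where it equals the rank of the differential by the
  law of nullity \<open>\<rho>(f) + \<rho>(g) \<le> \<rho>(g f) + \<rho>(Y)\<close>.\<close>

section \<open>Block matrices\<close>

text \<open>Degree by degree, each axiom for the extension is a statement about finitely many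
  matrices. So it suffices to treat a rank \<open>r\<close> on bare matrices, and an inequality
  \<open>r N' \<le> r N\<close> is certified by an explicit factorisation
  \<open>N' = P * N * Q\<close>. The idempotents that cut out projective modules survive only
  through equations such as \<open>dY * e = dY\<close>. The obstacle in the uniqueness part is that
  the triangle axiom sees only the first two maps of a triangle. Reaching the third map and the
  shift requires rotated triangles to be exact again, which in this model is an explicit homotopy
  equivalence between \<Sigma>X and an iterated cone. The grading isolates the attaching maps: a
  term in degree k contributes only to the power q^(-k), so the terms above it cannot interfere in
  that power. This is where Laurent polynomials matter. With a finite period the degrees wrap
  around, and for even d the factor 1 + q divides q^d - 1 and becomes a zero divisor.\<close>

definition append_cols :: "'a :: zero mat \<Rightarrow> 'a mat \<Rightarrow> 'a mat" (infixr \<open>@\<^sub>c\<close> 65) where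
  "A @\<^sub>c B = four_block_mat A B (0\<^sub>m 0 (dim_col A)) (0\<^sub>m 0 (dim_col B))"

lemma dim_append_rows [simp]:
  "dim_row (A @\<^sub>r B) = dim_row A + dim_row B" "dim_col (A @\<^sub>r B) = dim_col A"
  by (auto simp: append_rows_def)

lemma dim_append_cols [simp]:
  "dim_row (A @\<^sub>c B) = dim_row A" "dim_col (A @\<^sub>c B) = dim_col A + dim_col B"
  by (auto simp: append_cols_def)

lemma dim_bdiag [simp]:
  "dim_row (bdiag A B) = dim_row A + dim_row B" "dim_col (bdiag A B) = dim_col A + dim_col B"
  by (auto simp: bdiag_def)

lemma dim_utri [simp]:
  "dim_row (utri A B C) = dim_row A + dim_row C" "dim_col (utri A B C) = dim_col A + dim_col C"
  by (auto simp: utri_def)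

lemma mat_add_0 [simp]:
  "dim_row A = n \<Longrightarrow> dim_col A = m \<Longrightarrow> 0\<^sub>m n m + A = (A :: 'a::monoid_add mat)"
  "dim_row A = n \<Longrightarrow> dim_col A = m \<Longrightarrow> A + 0\<^sub>m n m = A"
  by (auto intro!: eq_matI)

lemma mat_minus_0 [simp]:
  "dim_row A = n \<Longrightarrow> dim_col A = m \<Longrightarrow> A - 0\<^sub>m n m = (A :: 'a::group_add mat)"
  "dim_row A = n \<Longrightarrow> dim_col A = m \<Longrightarrow> 0\<^sub>m n m - A = - A"
  "- (0\<^sub>m n m) = (0\<^sub>m n m :: 'a mat)"
  by (auto intro!: eq_matI)

lemma mat_add_uminus [simp]:
  "- A + A = (0\<^sub>m (dim_row A) (dim_col A) :: 'a::group_add mat)"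
  "A + - A = (0\<^sub>m (dim_row A) (dim_col A) :: 'a::group_add mat)"
  "A - A = (0\<^sub>m (dim_row A) (dim_col A) :: 'a::group_add mat)"
  by (auto intro!: eq_matI)

lemma mat_mult_1 [simp]:
  "dim_row A = n \<Longrightarrow> 1\<^sub>m n * A = (A :: 'a::semiring_1 mat)"
  "dim_col A = n \<Longrightarrow> A * 1\<^sub>m n = A"
  by (auto intro!: eq_matI)

lemma mat_assoc:
  "dim_col A = dim_row B \<Longrightarrow> dim_col B = dim_row C \<Longrightarrow>
    (A * B) * C = A * (B * C :: 'a::ring mat)"
  by (rule assoc_mult_mat) auto

lemma mat_distrib:
  "dim_col A = dim_row B \<Longrightarrow> dim_row B = dim_row C \<Longrightarrow> dim_col B = dim_col C \<Longrightarrow>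
    A * (B + C) = A * B + A * (C :: 'a::ring mat)"
  "dim_row A = dim_row B \<Longrightarrow> dim_col A = dim_col B \<Longrightarrow> dim_col A = dim_row C \<Longrightarrow>
    (A + B) * C = A * C + B * (C :: 'a::ring mat)"
  by (rule mult_add_distrib_mat add_mult_distrib_mat; auto)+

lemma mat_distrib_minus:
  "dim_col A = dim_row B \<Longrightarrow> dim_row B = dim_row C \<Longrightarrow> dim_col B = dim_col C \<Longrightarrow>
    A * (B - C) = A * B - A * (C :: 'a::ring mat)"
  "dim_row A = dim_row B \<Longrightarrow> dim_col A = dim_col B \<Longrightarrow> dim_col A = dim_row C \<Longrightarrow>
    (A - B) * C = A * C - B * (C :: 'a::ring mat)"
  by (rule mult_minus_distrib_mat minus_mult_distrib_mat; auto)+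

lemma four_block_mult:
  "dim_row B1 = dim_row A1 \<Longrightarrow> dim_col C1 = dim_col A1 \<Longrightarrow> dim_row C1 = dim_row D1 \<Longrightarrow>
   dim_col B1 = dim_col D1 \<Longrightarrow> dim_row A2 = dim_col A1 \<Longrightarrow> dim_row B2 = dim_col A1 \<Longrightarrow>
   dim_row C2 = dim_col D1 \<Longrightarrow> dim_row D2 = dim_col D1 \<Longrightarrow> dim_col C2 = dim_col A2 \<Longrightarrow>
   dim_col B2 = dim_col D2 \<Longrightarrow>
   four_block_mat A1 B1 C1 D1 * four_block_mat A2 B2 C2 D2
    = four_block_mat (A1 * A2 + B1 * C2) (A1 * B2 + B1 * D2)
        (C1 * A2 + D1 * C2) (C1 * B2 + D1 * D2 :: 'a::ring mat)"
  by (rule mult_four_block_mat) (auto intro!: carrier_matI)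

lemma four_block_add:
  "dim_row B1 = dim_row A1 \<Longrightarrow> dim_col C1 = dim_col A1 \<Longrightarrow> dim_row C1 = dim_row D1 \<Longrightarrow>
   dim_col B1 = dim_col D1 \<Longrightarrow> dim_row A2 = dim_row A1 \<Longrightarrow> dim_row B2 = dim_row A1 \<Longrightarrow>
   dim_row C2 = dim_row D1 \<Longrightarrow> dim_row D2 = dim_row D1 \<Longrightarrow> dim_col A2 = dim_col A1 \<Longrightarrow>
   dim_col C2 = dim_col A1 \<Longrightarrow> dim_col B2 = dim_col D1 \<Longrightarrow> dim_col D2 = dim_col D1 \<Longrightarrow>
   four_block_mat A1 B1 C1 D1 + four_block_mat A2 B2 C2 D2
    = four_block_mat (A1 + A2) (B1 + B2) (C1 + C2) (D1 + D2 :: 'a::ring mat)"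
  by (rule add_four_block_mat) (auto intro!: carrier_matI)

lemma four_block_minus:
  "dim_row B1 = dim_row A1 \<Longrightarrow> dim_col C1 = dim_col A1 \<Longrightarrow> dim_row C1 = dim_row D1 \<Longrightarrow>
   dim_col B1 = dim_col D1 \<Longrightarrow> dim_row A2 = dim_row A1 \<Longrightarrow> dim_row B2 = dim_row A1 \<Longrightarrow>
   dim_row C2 = dim_row D1 \<Longrightarrow> dim_row D2 = dim_row D1 \<Longrightarrow> dim_col A2 = dim_col A1 \<Longrightarrow>
   dim_col C2 = dim_col A1 \<Longrightarrow> dim_col B2 = dim_col D1 \<Longrightarrow> dim_col D2 = dim_col D1 \<Longrightarrow>
   four_block_mat A1 B1 C1 D1 - four_block_mat A2 B2 C2 D2
    = four_block_mat (A1 - A2) (B1 - B2) (C1 - C2) (D1 - D2 :: 'a::ring mat)"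
  by (rule eq_matI) auto

lemma four_block_uminus:
  "dim_row B = dim_row A \<Longrightarrow> dim_col C = dim_col A \<Longrightarrow> dim_row C = dim_row D \<Longrightarrow>
   dim_col B = dim_col D \<Longrightarrow>
   - four_block_mat A B C D = four_block_mat (- A) (- B) (- C) (- D :: 'a::ring mat)"
  by (rule eq_matI) auto

lemma append_rows_add:
  "dim_row A = dim_row C \<Longrightarrow> dim_col A = dim_col C \<Longrightarrow> dim_row B = dim_row D \<Longrightarrow>
   dim_col B = dim_col D \<Longrightarrow> dim_col B = dim_col A \<Longrightarrow>
   (A @\<^sub>r B) + (C @\<^sub>r D) = (A + C) @\<^sub>r (B + D :: 'a::ring mat)"
  "dim_row A = dim_row C \<Longrightarrow> dim_col A = dim_col C \<Longrightarrow> dim_row B = dim_row D \<Longrightarrow>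
   dim_col B = dim_col D \<Longrightarrow> dim_col B = dim_col A \<Longrightarrow>
   (A @\<^sub>r B) - (C @\<^sub>r D) = (A - C) @\<^sub>r (B - D :: 'a mat)"
  "dim_col F = dim_col E \<Longrightarrow> - (E @\<^sub>r F) = (- E) @\<^sub>r (- F :: 'a mat)"
  "0\<^sub>m n k @\<^sub>r 0\<^sub>m m k = (0\<^sub>m (n + m) k :: 'a mat)"
  by (auto simp: append_rows_def intro!: eq_matI)

lemma append_cols_add:
  "dim_row A = dim_row C \<Longrightarrow> dim_col A = dim_col C \<Longrightarrow> dim_row B = dim_row D \<Longrightarrow>
   dim_col B = dim_col D \<Longrightarrow> dim_row B = dim_row A \<Longrightarrow>
   (A @\<^sub>c B) + (C @\<^sub>c D) = (A + C) @\<^sub>c (B + D :: 'a::ring mat)"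
  "dim_row A = dim_row C \<Longrightarrow> dim_col A = dim_col C \<Longrightarrow> dim_row B = dim_row D \<Longrightarrow>
   dim_col B = dim_col D \<Longrightarrow> dim_row B = dim_row A \<Longrightarrow>
   (A @\<^sub>c B) - (C @\<^sub>c D) = (A - C) @\<^sub>c (B - D :: 'a mat)"
  "dim_row F = dim_row E \<Longrightarrow> - (E @\<^sub>c F) = (- E) @\<^sub>c (- F :: 'a mat)"
  "0\<^sub>m k n @\<^sub>c 0\<^sub>m k m = (0\<^sub>m k (n + m) :: 'a mat)"
  by (auto simp: append_cols_def intro!: eq_matI)

text \<open>All blocks but one have a vanishing dimension. Complexes supported in few degrees
  produce such blocks, which may still carry one nonzero dimension.\<close>

lemma degenerate_four_block:
  "dim_row B = dim_row A \<Longrightarrow> dim_col B = 0 \<Longrightarrow> dim_col C = dim_col A \<Longrightarrow> dim_row C = 0 \<Longrightarrow>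
    dim_row D = 0 \<Longrightarrow> dim_col D = 0 \<Longrightarrow> four_block_mat A B C D = A"
  "dim_row B = 0 \<Longrightarrow> dim_col B = dim_col D \<Longrightarrow> dim_col C = 0 \<Longrightarrow> dim_row C = dim_row D \<Longrightarrow>
    dim_row A = 0 \<Longrightarrow> dim_col A = 0 \<Longrightarrow> four_block_mat A B C D = D"
  "dim_row B = dim_row A \<Longrightarrow> dim_col B = dim_col D \<Longrightarrow> dim_col C = 0 \<Longrightarrow> dim_row C = 0 \<Longrightarrow>
    dim_col A = 0 \<Longrightarrow> dim_row D = 0 \<Longrightarrow> four_block_mat A B C D = B"
  "dim_row B = 0 \<Longrightarrow> dim_col B = 0 \<Longrightarrow> dim_col C = dim_col A \<Longrightarrow> dim_row C = dim_row D \<Longrightarrow>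
    dim_row A = 0 \<Longrightarrow> dim_col D = 0 \<Longrightarrow> four_block_mat A B C D = C"
  by (auto intro!: eq_matI)

lemma append_mult:
  fixes A :: "'a::ring mat"
  shows "dim_row B = dim_row A \<Longrightarrow> dim_row C = dim_col A \<Longrightarrow> dim_row D = dim_col B \<Longrightarrow>
      dim_col D = dim_col C \<Longrightarrow> (A @\<^sub>c B) * (C @\<^sub>r D) = A * C + B * D"
    and "dim_col B = dim_col A \<Longrightarrow> dim_row C = dim_col A \<Longrightarrow> dim_row D = dim_row C \<Longrightarrow>
      (A @\<^sub>r B) * (C @\<^sub>c D) = four_block_mat (A * C) (A * D) (B * C) (B * D)"
    and "dim_col B = dim_col A \<Longrightarrow> dim_row C = dim_col A \<Longrightarrow>
      (A @\<^sub>r B) * C = (A * C) @\<^sub>r (B * C)"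
    and "dim_row D = dim_row C \<Longrightarrow> dim_row C = dim_col A \<Longrightarrow>
      A * (C @\<^sub>c D) = (A * C) @\<^sub>c (A * D)"
    and "dim_row B = dim_row A \<Longrightarrow> dim_row A' = dim_col A \<Longrightarrow> dim_row B' = dim_col A \<Longrightarrow>
      dim_row C' = dim_col B \<Longrightarrow> dim_row D' = dim_col B \<Longrightarrow> dim_col C' = dim_col A' \<Longrightarrow>
      dim_col D' = dim_col B' \<Longrightarrow>
      (A @\<^sub>c B) * four_block_mat A' B' C' D' = (A * A' + B * C') @\<^sub>c (A * B' + B * D')"
    and "dim_row B' = dim_row A' \<Longrightarrow> dim_col C' = dim_col A' \<Longrightarrow> dim_row C' = dim_row D' \<Longrightarrow>
      dim_col B' = dim_col D' \<Longrightarrow> dim_row C = dim_col A' \<Longrightarrow> dim_row D = dim_col D' \<Longrightarrow>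
      dim_col D = dim_col C \<Longrightarrow>
      four_block_mat A' B' C' D' * (C @\<^sub>r D) = (A' * C + B' * D) @\<^sub>r (C' * C + D' * D)"
proof -
  \<comment> \<open>Padding with empty blocks turns a single factor into a
    \<open>four_block_mat\<close>, so that one product rule covers the mixed cases.\<close>
  have R: "X = four_block_mat X (0\<^sub>m (dim_row X) 0) (0\<^sub>m 0 (dim_col X)) (0\<^sub>m 0 0)" for X :: "'a mat"
    by (simp add: degenerate_four_block)
  show "(A @\<^sub>c B) * (C @\<^sub>r D) = A * C + B * D"
    if "dim_row B = dim_row A" "dim_row C = dim_col A" "dim_row D = dim_col B" "dim_col D = dim_col C"
    using that by (simp add: append_cols_def append_rows_def four_block_mult degenerate_four_block)
  show "(A @\<^sub>r B) * (C @\<^sub>c D) = four_block_mat (A * C) (A * D) (B * C) (B * D)"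
    if "dim_col B = dim_col A" "dim_row C = dim_col A" "dim_row D = dim_row C"
    using that by (simp add: append_cols_def append_rows_def four_block_mult)
  show "(A @\<^sub>r B) * C = (A * C) @\<^sub>r (B * C)"
    if "dim_col B = dim_col A" "dim_row C = dim_col A"
    using that by (subst R[of C]) (simp add: append_rows_def four_block_mult)
  show "A * (C @\<^sub>c D) = (A * C) @\<^sub>c (A * D)"
    if "dim_row D = dim_row C" "dim_row C = dim_col A"
    using that by (subst R[of A]) (simp add: append_cols_def four_block_mult)
  show "(A @\<^sub>c B) * four_block_mat A' B' C' D' = (A * A' + B * C') @\<^sub>c (A * B' + B * D')"
    if "dim_row B = dim_row A" "dim_row A' = dim_col A" "dim_row B' = dim_col A"
      "dim_row C' = dim_col B" "dim_row D' = dim_col B" "dim_col C' = dim_col A'" "dim_col D' = dim_col B'"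
    using that by (simp add: append_cols_def four_block_mult)
  show "four_block_mat A' B' C' D' * (C @\<^sub>r D) = (A' * C + B' * D) @\<^sub>r (C' * C + D' * D)"
    if "dim_row B' = dim_row A'" "dim_col C' = dim_col A'" "dim_row C' = dim_row D'"
      "dim_col B' = dim_col D'" "dim_row C = dim_col A'" "dim_row D = dim_col D'" "dim_col D = dim_col C"
    using that by (simp add: append_rows_def four_block_mult)
qed

lemma append_cols_rows:
  "dim_row A = dim_row C \<Longrightarrow> dim_row B = dim_row D \<Longrightarrow> dim_col B = dim_col A \<Longrightarrow> dim_col D = dim_col C \<Longrightarrow>
    (A @\<^sub>r B) @\<^sub>c (C @\<^sub>r D) = four_block_mat A C B D"
  "dim_row A = n \<Longrightarrow> dim_row B = m \<Longrightarrow> dim_col B = dim_col A \<Longrightarrow>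
    0\<^sub>m (n + m) k @\<^sub>c (A @\<^sub>r B) = four_block_mat (0\<^sub>m n k) A (0\<^sub>m m k) B"
  "dim_row A = n \<Longrightarrow> dim_row B = m \<Longrightarrow> dim_col B = dim_col A \<Longrightarrow>
    (A @\<^sub>r B) @\<^sub>c 0\<^sub>m (n + m) k = four_block_mat A (0\<^sub>m n k) B (0\<^sub>m m k)"
  by (auto simp: append_rows_def append_cols_def intro!: eq_matI)

text \<open>Pushes sums and products into the blocks, so that an explicit factorisation is verified
  by comparing blocks.\<close>

lemmas block_simps = append_cols_rows bdiag_def utri_def four_block_mult four_block_add four_block_minus
  four_block_uminus append_rows_add append_cols_add append_mult mat_assoc

section \<open>Ranks of block matrices\<close>

text \<open>The Sylvester axioms for maps between free modules: source and target are read off from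
  the dimensions, so the rank takes the matrix as its only argument.\<close>

locale mat_rank =
  fixes r :: "'a::ring_1 mat \<Rightarrow> real"
  assumes nonneg: "0 \<le> r A"
    and rank_bdiag: "r (bdiag A B) = r A + r B"
    and rank_utri: "dim_row C = dim_row A \<Longrightarrow> dim_col C = dim_col B \<Longrightarrow>
          r A + r B \<le> r (utri A C B)"
    and rank_mult: "dim_col A = dim_row B \<Longrightarrow> r (A * B) \<le> r A"
                   "dim_col A = dim_row B \<Longrightarrow> r (A * B) \<le> r B"
begin

text \<open>The workhorse for all rank comparisons: block row operations go into \<open>P\<close>,
  block column operations into \<open>Q\<close>. Invertible operations are used in both directions
  and give equalities.\<close>

lemma rank_le_conj:
  assumes "N' = P * N * Q" "dim_col P = dim_row N" "dim_col N = dim_row Q"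
  shows "r N' \<le> r N"
proof -
  have "r (P * N * Q) \<le> r (P * N)" by (rule rank_mult) (use assms in auto)
  also have "\<dots> \<le> r N" by (rule rank_mult) (use assms in auto)
  finally show ?thesis using assms by simp
qed

text \<open>The empty matrix is the direct sum of two copies of itself, so its rank is its own
  double; every zero matrix factors through it.\<close>

lemma rank_0 [simp]: "r (0\<^sub>m n m) = 0"
proof -
  have "r (0\<^sub>m 0 0) = r (bdiag (0\<^sub>m 0 0) (0\<^sub>m 0 0))" by (simp add: bdiag_def)
  hence z: "r (0\<^sub>m 0 0) = 0" by (simp only: rank_bdiag)
  have "r (0\<^sub>m n m) \<le> r (0\<^sub>m 0 0)"
    by (rule rank_le_conj[where P = "0\<^sub>m n 0" and Q = "0\<^sub>m 0 m"]) auto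
  with z nonneg[of "0\<^sub>m n m"] show ?thesis by simp
qed

lemma rank_uminus [simp]: "r (- A) = r A"
proof -
  have "r (- A) \<le> r A" for A
    by (rule rank_le_conj[where P = "- 1\<^sub>m (dim_row A)" and Q = "1\<^sub>m (dim_col A)"]) auto
  from this[of A] this[of "- A"] show ?thesis by simp
qed

text \<open>If d and d' are the differentials at the source of \<open>f\<close> and into the target of \<open>f\<close>,
  then \<open>coh_rank d f d'\<close> is, over a field, the rank of the map induced by \<open>f\<close> on cohomology:
  the image of the block matrix is an extension of \<open>im d\<close> by \<open>f (ker d) + im d'\<close>.\<close>

definition lower :: "'a mat \<Rightarrow> 'a mat \<Rightarrow> 'a mat \<Rightarrow> 'a mat" where
  "lower d f d' = four_block_mat d (0\<^sub>m (dim_row d) (dim_col d')) f d'"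

definition coh_rank :: "'a mat \<Rightarrow> 'a mat \<Rightarrow> 'a mat \<Rightarrow> real" where
  "coh_rank d f d' = r (lower d f d') - r d - r d'"

lemma dim_lower [simp]:
  "dim_row (lower d f d') = dim_row d + dim_row d'" "dim_col (lower d f d') = dim_col d + dim_col d'"
  by (auto simp: lower_def)

text \<open>Exchanging the two block rows and the two block columns turns the upper triangular axiom
  into its lower triangular form.\<close>

lemma rank_lower:
  assumes "dim_row f = dim_row d'" "dim_col f = dim_col d"
  shows "r d + r d' \<le> r (lower d f d')"
proof -
  have "r d' + r d \<le> r (utri d' f d)" by (rule rank_utri) (use assms in auto)
  also have "\<dots> \<le> r (lower d f d')"
    by (rule rank_le_conj[where
        P = "four_block_mat (0\<^sub>m (dim_row d') (dim_row d)) (1\<^sub>m (dim_row d')) (1\<^sub>m (dim_row d)) (0\<^sub>m (dim_row d) (dim_row d'))"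
        and Q = "four_block_mat (0\<^sub>m (dim_col d) (dim_col d')) (1\<^sub>m (dim_col d)) (1\<^sub>m (dim_col d')) (0\<^sub>m (dim_col d') (dim_col d))"])
      (use assms in \<open>auto simp: block_simps lower_def\<close>)
  finally show ?thesis by simp
qed

lemma coh_rank_nonneg:
  "dim_row f = dim_row d' \<Longrightarrow> dim_col f = dim_col d \<Longrightarrow> 0 \<le> coh_rank d f d'"
  using rank_lower[of f d' d] by (simp add: coh_rank_def)

text \<open>A homotopy acts by unipotent operations: \<open>h'\<close> times the row of
  \<open>d\<close> and the column of \<open>d'\<close> times \<open>h\<close> are added to the block
  \<open>f\<close>.\<close>

lemma coh_rank_homotopy:
  assumes "dim_row f = dim_row d'" "dim_col f = dim_col d"
    "dim_row h' = dim_row d'" "dim_col h' = dim_row d"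
    "dim_row h = dim_col d'" "dim_col h = dim_col d"
  shows "coh_rank d (f + (d' * h + h' * d)) d' = coh_rank d f d'"
proof -
  have *: "r (lower d (f + (d' * h + h' * d)) d') \<le> r (lower d f d')"
    if d: "dim_row f = dim_row d'" "dim_col f = dim_col d"
      "dim_row h' = dim_row d'" "dim_col h' = dim_row d"
      "dim_row h = dim_col d'" "dim_col h = dim_col d" for f h h'
  proof (rule rank_le_conj[where
        P = "four_block_mat (1\<^sub>m (dim_row d)) (0\<^sub>m (dim_row d) (dim_row d')) h' (1\<^sub>m (dim_row d'))"
        and Q = "four_block_mat (1\<^sub>m (dim_col d)) (0\<^sub>m (dim_col d) (dim_col d')) h (1\<^sub>m (dim_col d'))"])
    have "h' * d + f + d' * h = f + (d' * h + h' * d)"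
      by (rule eq_matI) (use d in \<open>auto simp: ac_simps\<close>)
    then show "lower d (f + (d' * h + h' * d)) d' =
      four_block_mat (1\<^sub>m (dim_row d)) (0\<^sub>m (dim_row d) (dim_row d')) h' (1\<^sub>m (dim_row d')) * lower d f d' *
      four_block_mat (1\<^sub>m (dim_col d)) (0\<^sub>m (dim_col d) (dim_col d')) h (1\<^sub>m (dim_col d'))"
      using d by (simp add: block_simps lower_def)
  qed (use d in auto)
  \<comment> \<open>The operation is undone by the homotopy with both signs reversed, which gives
    the other inequality.\<close>
  have "f + (d' * h + h' * d) + (d' * - h + - h' * d) = f"
    by (rule eq_matI) (use assms in auto)
  with *[of f h' h] *[of "f + (d' * h + h' * d)" "- h'" "- h"] assms show ?thesis
    by (simp add: coh_rank_def)
qed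

text \<open>Negating the first block row and the second block column changes the sign of both
  differentials and keeps \<open>f\<close>. This is needed because the shift negates
  differentials.\<close>

lemma coh_rank_uminus:
  assumes "dim_row f = dim_row d'" "dim_col f = dim_col d"
  shows "coh_rank (- d) f (- d') = coh_rank d f d'"
proof -
  have *: "r (lower (- d) f (- d')) \<le> r (lower d f d')"
    if d: "dim_row f = dim_row d'" "dim_col f = dim_col d" for d d' f
    by (rule rank_le_conj[where
        P = "four_block_mat (- 1\<^sub>m (dim_row d)) (0\<^sub>m (dim_row d) (dim_row d')) (0\<^sub>m (dim_row d') (dim_row d)) (1\<^sub>m (dim_row d'))"
        and Q = "four_block_mat (1\<^sub>m (dim_col d)) (0\<^sub>m (dim_col d) (dim_col d')) (0\<^sub>m (dim_col d') (dim_col d)) (- 1\<^sub>m (dim_col d'))"])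
      (use d in \<open>auto simp: block_simps lower_def\<close>)
  from *[of f d' d] *[of f "- d'" "- d"] assms show ?thesis by (simp add: coh_rank_def)
qed

lemma rank_lower_utri_shuffle:
  assumes "dim_row f = dim_row d'" "dim_col f = dim_col d"
    and "dim_row g = dim_row c'" "dim_col g = dim_col c"
    and "dim_row h = dim_row d'" "dim_col h = dim_col c"
  shows "r (lower (bdiag d c) (utri f h g) (bdiag d' c')) =
    r (utri (lower d f d') (four_block_mat (0\<^sub>m (dim_row d) (dim_col c)) (0\<^sub>m (dim_row d) (dim_col c')) h
         (0\<^sub>m (dim_row d') (dim_col c'))) (lower c g c'))" (is "r ?M = r ?N")
proof (rule antisym)
  \<comment> \<open>The permutation matrix that exchanges the two middle blocks of a decomposition
    into four blocks of sizes \<open>a\<close>, \<open>b\<close>, \<open>c\<close>,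
    \<open>d\<close>.\<close>
  let ?S = "\<lambda>a b c d. four_block_mat
     (four_block_mat (1\<^sub>m a) (0\<^sub>m a b) (0\<^sub>m c a) (0\<^sub>m c b)) (four_block_mat (0\<^sub>m a c) (0\<^sub>m a d) (1\<^sub>m c) (0\<^sub>m c d))
     (four_block_mat (0\<^sub>m b a) (1\<^sub>m b) (0\<^sub>m d a) (0\<^sub>m d b)) (four_block_mat (0\<^sub>m b c) (0\<^sub>m b d) (0\<^sub>m d c) (1\<^sub>m d)) :: 'a mat"
  show "r ?M \<le> r ?N"
    by (rule rank_le_conj[where P = "?S (dim_row d) (dim_row d') (dim_row c) (dim_row c')"
          and Q = "?S (dim_col d) (dim_col c) (dim_col d') (dim_col c')"])
      (use assms in \<open>auto simp: block_simps lower_def\<close>)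
  show "r ?N \<le> r ?M"
    by (rule rank_le_conj[where P = "?S (dim_row d) (dim_row c) (dim_row d') (dim_row c')"
          and Q = "?S (dim_col d) (dim_col d') (dim_col c) (dim_col c')"])
      (use assms in \<open>auto simp: block_simps lower_def\<close>)
qed

lemma coh_rank_bdiag:
  assumes "dim_row f = dim_row d'" "dim_col f = dim_col d"
    and "dim_row g = dim_row c'" "dim_col g = dim_col c"
  shows "coh_rank (bdiag d c) (bdiag f g) (bdiag d' c') = coh_rank d f d' + coh_rank c g c'"
proof -
  have "bdiag f g = utri f (0\<^sub>m (dim_row d') (dim_col c)) g"
    using assms by (simp add: bdiag_def utri_def)
  moreover have "utri (lower d f d') (four_block_mat (0\<^sub>m (dim_row d) (dim_col c)) (0\<^sub>m (dim_row d) (dim_col c'))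
      (0\<^sub>m (dim_row d') (dim_col c)) (0\<^sub>m (dim_row d') (dim_col c'))) (lower c g c') =
    bdiag (lower d f d') (lower c g c')"
    using assms by (simp add: bdiag_def utri_def)
  ultimately show ?thesis
    using assms rank_lower_utri_shuffle[of f d' d g c' c "0\<^sub>m (dim_row d') (dim_col c)"]
    by (simp add: coh_rank_def rank_bdiag)
qed

text \<open>After the shuffle the matrix is block triangular with the two \<open>lower\<close>
  matrices on the diagonal. The ranks of the differentials add up exactly, so the triangular axiom
  passes to \<open>coh_rank\<close>.\<close>

lemma coh_rank_utri:
  assumes "dim_row f = dim_row d'" "dim_col f = dim_col d"
    and "dim_row g = dim_row c'" "dim_col g = dim_col c"
    and "dim_row h = dim_row d'" "dim_col h = dim_col c"
  shows "coh_rank d f d' + coh_rank c g c' \<le> coh_rank (bdiag d c) (utri f h g) (bdiag d' c')"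
proof -
  have "r (lower d f d') + r (lower c g c') \<le>
    r (utri (lower d f d') (four_block_mat (0\<^sub>m (dim_row d) (dim_col c)) (0\<^sub>m (dim_row d) (dim_col c')) h
         (0\<^sub>m (dim_row d') (dim_col c'))) (lower c g c'))"
    by (rule rank_utri) (use assms in \<open>auto simp: lower_def\<close>)
  with rank_lower_utri_shuffle[OF assms] show ?thesis by (simp add: coh_rank_def rank_bdiag)
qed

text \<open>Both composition laws are Frobenius inequalities: the two sides are compared through a
  block triangular matrix over the differential of the middle complex.\<close>

lemma coh_rank_comp_right:
  assumes "dim_row f = dim_row b" "dim_col f = dim_col d" "dim_col g = dim_row b"
    "dim_row g = dim_row c" "dim_row g' = dim_col c" "dim_col g' = dim_col b"
    and comm: "c * g' = g * b"
  shows "coh_rank d (g * f) c \<le> coh_rank d f b"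
proof -
  let ?dr = "dim_row d" and ?dc = "dim_col d" and ?br = "dim_row b" and ?bc = "dim_col b"
    and ?cr = "dim_row c" and ?cc = "dim_col c"
  have "r b + r (lower d (g * f) c) \<le> r (utri b (f @\<^sub>c 0\<^sub>m ?br ?cc) (lower d (g * f) c))"
    by (rule rank_utri) (use assms in auto)
  \<comment> \<open>The row \<open>(f, b)\<close> multiplied by \<open>g\<close> yields the wanted
    \<open>g * f\<close> together with an unwanted \<open>g * b\<close> in the column of
    \<open>b\<close>. Since \<open>c * g' = g * b\<close>, the entry \<open>- g'\<close> of
    \<open>Q\<close> cancels it against \<open>c\<close>.\<close>
  also have "\<dots> \<le> r (bdiag (lower d f b) c)"
    by (rule rank_le_conj[where
        P = "four_block_mat (0\<^sub>m ?br ?dr @\<^sub>c 1\<^sub>m ?br) (0\<^sub>m ?br ?cr)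
               (four_block_mat (1\<^sub>m ?dr) (0\<^sub>m ?dr ?br) (0\<^sub>m ?cr ?dr) g) (0\<^sub>m ?dr ?cr @\<^sub>r 1\<^sub>m ?cr)"
        and Q = "four_block_mat (0\<^sub>m ?dc ?bc @\<^sub>r 1\<^sub>m ?bc) (four_block_mat (1\<^sub>m ?dc) (0\<^sub>m ?dc ?cc) (0\<^sub>m ?bc ?dc) (0\<^sub>m ?bc ?cc))
               (- g') (0\<^sub>m ?cc ?dc @\<^sub>c 1\<^sub>m ?cc)"])
      (use assms in \<open>auto simp: block_simps lower_def\<close>)
  finally show ?thesis by (simp add: coh_rank_def rank_bdiag)
qed

lemma coh_rank_comp_left:
  assumes "dim_row g = dim_row c" "dim_col g = dim_col b" "dim_row f = dim_col b"
    "dim_col f = dim_col d" "dim_row f' = dim_row b" "dim_col f' = dim_row d"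
    and comm: "b * f = f' * d"
  shows "coh_rank d (g * f) c \<le> coh_rank b g c"
proof -
  let ?dr = "dim_row d" and ?dc = "dim_col d" and ?br = "dim_row b" and ?bc = "dim_col b"
    and ?cr = "dim_row c" and ?cc = "dim_col c"
  have "r (lower d (g * f) c) + r b \<le> r (utri (lower d (g * f) c) (0\<^sub>m ?dr ?bc @\<^sub>r g) b)"
    by (rule rank_utri) (use assms in auto)
  \<comment> \<open>Dually, the column formed by \<open>b\<close> and \<open>g\<close>, multiplied
    by \<open>f\<close>, yields \<open>g * f\<close> together with \<open>b * f\<close>. Since
    \<open>b * f = f' * d\<close>, the entry \<open>- f'\<close> of \<open>P\<close> clears it with
    the row of \<open>d\<close>.\<close>
  also have "\<dots> \<le> r (bdiag d (lower b g c))"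
    by (rule rank_le_conj[where
        P = "four_block_mat (1\<^sub>m ?dr @\<^sub>r 0\<^sub>m ?cr ?dr) (four_block_mat (0\<^sub>m ?dr ?br) (0\<^sub>m ?dr ?cr) (0\<^sub>m ?cr ?br) (1\<^sub>m ?cr))
               (- f') (1\<^sub>m ?br @\<^sub>c 0\<^sub>m ?br ?cr)"
        and Q = "four_block_mat (1\<^sub>m ?dc @\<^sub>c 0\<^sub>m ?dc ?cc) (0\<^sub>m ?dc ?bc)
               (four_block_mat f (0\<^sub>m ?bc ?cc) (0\<^sub>m ?cc ?dc) (1\<^sub>m ?cc)) (1\<^sub>m ?bc @\<^sub>r 0\<^sub>m ?cc ?bc)"])
      (use assms in \<open>auto simp: block_simps lower_def\<close>)
  finally show ?thesis by (simp add: coh_rank_def rank_bdiag)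
qed

end

section \<open>Chain maps and homotopies\<close>

lemma pobjD:
  assumes "pobj e"
  shows "dim_col e = dim_row e" "e * e = e"
  using assms by (auto simp: pobj_def)

lemma pmorD:
  assumes "pmor e e' f"
  shows "dim_row f = dim_row e'" "dim_col f = dim_row e"
  using assms by (auto simp: pmor_def)

lemma pmor_absorb:
  assumes "pmor e e' f" "pobj e" "pobj e'"
  shows "e' * f = f" "f * e = f"
proof -
  note d = pmorD[OF assms(1)] pobjD[OF assms(2)] pobjD[OF assms(3)]
  have f: "e' * f * e = f" using assms(1) by (simp add: pmor_def)
  have g: "e' * (f * e) = f" using d f by (simp add: mat_assoc)
  have "e' * f = (e' * e') * (f * e)" by (subst g[symmetric], subst mat_assoc) (use d in auto)
  then show "e' * f = f" using d g by simp
  have "f * e = (e' * f) * (e * e)" by (subst f[symmetric], subst mat_assoc) (use d in auto)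
  then show "f * e = f" using d f by simp
qed

lemma pmorI:
  assumes "dim_row f = dim_row e'" "dim_col f = dim_row e" "e' * f = f" "f * e = f"
  shows "pmor e e' f"
  using assms by (auto simp: pmor_def intro: carrier_matI)

lemma pobjI: "dim_col e = dim_row e \<Longrightarrow> e * e = e \<Longrightarrow> pobj e"
  by (auto simp: pobj_def intro: carrier_matI)

lemma pmor_comp:
  assumes "pobj e1" "pobj e2" "pobj e3" "pmor e1 e2 f" "pmor e2 e3 g"
  shows "pmor e1 e3 (g * f)"
proof (rule pmorI)
  note d = pmorD[OF assms(4)] pmorD[OF assms(5)] pobjD[OF assms(1)] pobjD[OF assms(2)] pobjD[OF assms(3)]
    pmor_absorb[OF assms(4,1,2)] pmor_absorb[OF assms(5,2,3)]
  show "dim_row (g * f) = dim_row e3" "dim_col (g * f) = dim_row e1" using d by auto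
  have "e3 * (g * f) = (e3 * g) * f" by (rule mat_assoc[symmetric]) (use d in auto)
  then show "e3 * (g * f) = g * f" using d by simp
  show "g * f * e1 = g * f" by (subst mat_assoc) (use d in auto)
qed

lemma pmor_0: "pobj e \<Longrightarrow> pobj e' \<Longrightarrow> pmor e e' (0\<^sub>m (dim_row e') (dim_row e))"
  by (rule pmorI) (auto dest: pobjD)

lemma cxD:
  assumes "cx X"
  shows "pobj (fst X i)" "pmor (fst X i) (fst X (i + 1)) (snd X i)"
    "snd X (i + 1) * snd X i = 0\<^sub>m (dim_row (fst X (i + 2))) (dim_row (fst X i))"
    "dim_col (fst X i) = dim_row (fst X i)"
    "dim_row (snd X i) = dim_row (fst X (i + 1))" "dim_col (snd X i) = dim_row (fst X i)"
    "fst X i * fst X i = fst X i" "fst X (i + 1) * snd X i = snd X i" "snd X i * fst X i = snd X i"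
proof -
  show 1: "pobj (fst X i)" for i using assms by (simp add: cx_def)
  show 2: "pmor (fst X i) (fst X (i + 1)) (snd X i)" using assms by (simp add: cx_def)
  show "snd X (i + 1) * snd X i = 0\<^sub>m (dim_row (fst X (i + 2))) (dim_row (fst X i))"
    using assms by (simp add: cx_def)
  show "dim_col (fst X i) = dim_row (fst X i)" "fst X i * fst X i = fst X i"
    using pobjD[OF 1] by auto
  show "dim_row (snd X i) = dim_row (fst X (i + 1))" "dim_col (snd X i) = dim_row (fst X i)"
    using pmorD[OF 2] by auto
  show "fst X (i + 1) * snd X i = snd X i" "snd X i * fst X i = snd X i"
    using pmor_absorb[OF 2 1 1] by auto
qed

lemma cx_finite: "cx X \<Longrightarrow> finite {i. dim_row (fst X i) \<noteq> 0}"
  by (simp add: cx_def)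

text \<open>The facts about the differential arriving in degree \<open>i\<close>, stated for the
  index \<open>i - 1\<close> in the form in which the definitions of homotopies and of
  \<open>cx_rank\<close> use it.\<close>

lemma cx_prevD:
  assumes "cx X"
  shows "snd X i * snd X (i - 1) = 0\<^sub>m (dim_row (fst X (i + 1))) (dim_row (fst X (i - 1)))"
    "dim_row (snd X (i - 1)) = dim_row (fst X i)" "fst X i * snd X (i - 1) = snd X (i - 1)"
  using cxD[OF assms, of "i - 1"] by (auto simp: add.commute)

lemma chmD:
  assumes "chm X Y f"
  shows "pmor (fst X i) (fst Y i) (f i)" "snd Y i * f i = f (i + 1) * snd X i"
    "dim_row (f i) = dim_row (fst Y i)" "dim_col (f i) = dim_row (fst X i)"
  using assms pmorD[of "fst X i" "fst Y i" "f i"] by (auto simp: chm_def)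

lemma chm_absorb:
  assumes "cx X" "cx Y" "chm X Y f"
  shows "fst Y i * f i = f i" "f i * fst X i = f i"
  using pmor_absorb[OF chmD(1)[OF assms(3)] cxD(1)[OF assms(1)] cxD(1)[OF assms(2)]] by auto

lemma chmI:
  assumes "\<And>i. dim_row (f i) = dim_row (fst Y i)" "\<And>i. dim_col (f i) = dim_row (fst X i)"
    "\<And>i. fst Y i * f i = f i" "\<And>i. f i * fst X i = f i"
    "\<And>i. snd Y i * f i = f (i + 1) * snd X i"
  shows "chm X Y f"
  using assms by (auto simp: chm_def intro: pmorI)

lemma chm_idc: "cx X \<Longrightarrow> chm X X (idc X)"
  by (rule chmI) (auto simp: idc_def cxD)

lemma chm_comp:
  assumes "cx X" "cx Y" "cx Z" "chm X Y f" "chm Y Z g"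
  shows "chm X Z (comp g f)"
proof (unfold chm_def, intro conjI allI)
  fix i
  show "pmor (fst X i) (fst Z i) (comp g f i)"
    unfolding comp_def by (rule pmor_comp[where ?e2.0 = "fst Y i"]) (use assms in \<open>auto intro: cxD chmD\<close>)
  note d = chmD[OF assms(4)] chmD[OF assms(5)] cxD[OF assms(1)] cxD[OF assms(2)] cxD[OF assms(3)]
  have "snd Z i * (g i * f i) = g (i + 1) * (snd Y i * f i)"
    by (subst (1 2) mat_assoc[symmetric]) (use d in auto)
  also have "\<dots> = g (i + 1) * f (i + 1) * snd X i" using d by (simp add: mat_assoc)
  finally show "snd Z i * comp g f i = comp g f (i + 1) * snd X i" by (simp add: comp_def)
qed

lemma comp_assoc:
  assumes "chm X Y f" "chm Y Z g" "chm Z W h"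
  shows "comp (comp h g) f = comp h (comp g f)"
  by (rule ext, simp add: comp_def, rule mat_assoc) (auto simp: chmD[OF assms(1)] chmD[OF assms(2)] chmD[OF assms(3)])

lemma comp_idc:
  assumes "cx X" "cx Y" "chm X Y f"
  shows "comp f (idc X) = f" "comp (idc Y) f = f"
  using chm_absorb[OF assms] by (auto simp: comp_def idc_def)

lemma htp_refl:
  assumes "cx X" "cx Y" "chm X Y f"
  shows "htp X Y f f"
  unfolding htp_def
proof (intro exI conjI allI)
  fix i
  show "pmor (fst X i) (fst Y (i - 1)) (0\<^sub>m (dim_row (fst Y (i - 1))) (dim_row (fst X i)))"
    by (rule pmor_0) (use assms in \<open>auto intro: cxD\<close>)
  show "f i - f i = snd Y (i - 1) * (0\<^sub>m (dim_row (fst Y (i - 1))) (dim_row (fst X i))) +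
    0\<^sub>m (dim_row (fst Y (i + 1 - 1))) (dim_row (fst X (i + 1))) * snd X i"
    using cxD[OF assms(1)] cxD[OF assms(2)] cx_prevD[OF assms(2)] chmD[OF assms(3)] by auto
qed

text \<open>Since \<open>g\<close> commutes with the differentials, \<open>g\<close> composed with a
  homotopy is again a homotopy.\<close>

lemma htp_comp_left:
  assumes "cx X" "cx Y" "cx Z" "chm X Y f" "chm X Y f'" "chm Y Z g" "htp X Y f f'"
  shows "htp X Z (comp g f) (comp g f')"
proof -
  obtain h where h: "\<And>i. pmor (fst X i) (fst Y (i - 1)) (h i)"
    "\<And>i. f i - f' i = snd Y (i - 1) * h i + h (i + 1) * snd X i"
    using assms(7) by (auto simp: htp_def)
  note d = chmD[OF assms(4)] chmD[OF assms(5)] chmD[OF assms(6)] cxD[OF assms(1)] cxD[OF assms(2)]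
    cxD[OF assms(3)] pmorD[OF h(1)]
  show ?thesis unfolding htp_def
  proof (intro exI conjI allI)
    fix i
    show "pmor (fst X i) (fst Z (i - 1)) (g (i - 1) * h i)"
      by (rule pmor_comp[where ?e2.0 = "fst Y (i - 1)"]) (use assms h in \<open>auto intro: cxD chmD\<close>)
    have c: "snd Z (i - 1) * g (i - 1) = g i * snd Y (i - 1)" using chmD(2)[OF assms(6), of "i - 1"] by simp
    have d': "dim_row (snd Y (i - 1)) = dim_row (fst Y i)" "dim_row (snd Z (i - 1)) = dim_row (fst Z i)"
      using cx_prevD[OF assms(2)] cx_prevD[OF assms(3)] by auto
    have dh: "dim_row (h (i + 1)) = dim_row (fst Y i)" using pmorD[OF h(1)[of "i + 1"]] by simp
    have "g i * f i - g i * f' i = g i * (f i - f' i)"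
      by (rule mat_distrib_minus(1)[symmetric]) (use d in auto)
    also have "\<dots> = (g i * snd Y (i - 1)) * h i + g i * h (i + 1) * snd X i"
      unfolding h(2) by (subst mat_distrib) (use d d' dh in \<open>auto simp: mat_assoc\<close>)
    also have "\<dots> = snd Z (i - 1) * (g (i - 1) * h i) + g i * h (i + 1) * snd X i"
      unfolding c[symmetric] by (subst mat_assoc) (use d in auto)
    finally show "comp g f i - comp g f' i = snd Z (i - 1) * (g (i - 1) * h i) + g (i + 1 - 1) * h (i + 1) * snd X i"
      by (simp add: comp_def)
  qed
qed

lemma htp_comp_right:
  assumes "cx X" "cx Y" "cx Z" "chm X Y f" "chm Y Z g" "chm Y Z g'" "htp Y Z g g'"
  shows "htp X Z (comp g f) (comp g' f)"
proof -
  obtain h where h: "\<And>i. pmor (fst Y i) (fst Z (i - 1)) (h i)"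
    "\<And>i. g i - g' i = snd Z (i - 1) * h i + h (i + 1) * snd Y i"
    using assms(7) by (auto simp: htp_def)
  note d = chmD[OF assms(4)] chmD[OF assms(5)] chmD[OF assms(6)] cxD[OF assms(1)] cxD[OF assms(2)]
    cxD[OF assms(3)] pmorD[OF h(1)]
  show ?thesis unfolding htp_def
  proof (intro exI conjI allI)
    fix i
    show "pmor (fst X i) (fst Z (i - 1)) (h i * f i)"
      by (rule pmor_comp[where ?e2.0 = "fst Y i"]) (use assms h in \<open>auto intro: cxD chmD\<close>)
    have d': "dim_row (snd Z (i - 1)) = dim_row (fst Z i)"
      using cx_prevD[OF assms(3)] by auto
    have dh: "dim_row (h (i + 1)) = dim_row (fst Z i)" using pmorD[OF h(1)[of "i + 1"]] by simp
    have "g i * f i - g' i * f i = (g i - g' i) * f i"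
      by (rule mat_distrib_minus(2)[symmetric]) (use d in auto)
    also have "\<dots> = snd Z (i - 1) * (h i * f i) + h (i + 1) * (snd Y i * f i)"
      unfolding h(2) by (subst mat_distrib) (use d d' dh in \<open>auto simp: mat_assoc\<close>)
    also have "\<dots> = snd Z (i - 1) * (h i * f i) + h (i + 1) * f (i + 1) * snd X i"
      by (simp add: d, subst mat_assoc) (use d in auto)
    finally show "comp g f i - comp g' f i = snd Z (i - 1) * (h i * f i) + h (i + 1) * f (i + 1) * snd X i"
      by (simp add: comp_def)
  qed
qed

section \<open>Shifts, direct sums and cones of complexes\<close>

lemma cx_shiftc:
  assumes "cx X"
  shows "cx (shiftc X)"
proof -
  note d = cxD[OF assms]
  have "{i. dim_row (fst X (i + 1)) \<noteq> 0} = (\<lambda>i. i - 1) ` {i. dim_row (fst X i) \<noteq> 0}"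
    by (auto simp: image_iff intro!: exI[of _ "_ + 1"])
  then have fin: "finite {i. dim_row (fst X (i + 1)) \<noteq> 0}" using cx_finite[OF assms] by simp
  have "snd X (i + 2) * snd X (i + 1) = 0\<^sub>m (dim_row (fst X (i + 3))) (dim_row (fst X (i + 1)))" for i
    using d(3)[of "i + 1"] by (simp add: add.assoc)
  moreover have "pmor (fst X (i + 1)) (fst X (i + 2)) (- snd X (i + 1))" for i
    by (rule pmorI) (use d(4-)[of "i + 1"] d(4)[of "i + 2"] in \<open>auto simp: add.assoc\<close>)
  ultimately show ?thesis
    using fin d(1) d(5,6)[of "_ + 1"] d(5,6)[of "_ + 2"] by (simp add: cx_def shiftc_def add.assoc)
qed

lemma chm_shiftm:
  assumes "cx X" "cx Y" "chm X Y f"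
  shows "chm (shiftc X) (shiftc Y) (shiftm f)"
  using chmD[OF assms(3)] chm_absorb[OF assms] chmD(2)[OF assms(3), of "_ + 1"]
    cxD[OF assms(1)] cxD[OF assms(2)]
  by (intro chmI) (auto simp: shiftc_def shiftm_def add.assoc)

lemma cx_dsum:
  assumes "cx X" "cx Y"
  shows "cx (dsum X Y)"
proof -
  note d = cxD[OF assms(1)] cxD[OF assms(2)]
  have "{i. dim_row (fst X i) \<noteq> 0 \<or> dim_row (fst Y i) \<noteq> 0} =
    {i. dim_row (fst X i) \<noteq> 0} \<union> {i. dim_row (fst Y i) \<noteq> 0}" by auto
  then have fin: "finite {i. dim_row (fst X i) \<noteq> 0 \<or> dim_row (fst Y i) \<noteq> 0}"
    using assms[THEN cx_finite] by simp
  have fin': "finite {i. dim_row (fst X i) = 0 \<longrightarrow> 0 < dim_row (fst Y i)}"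
    by (rule finite_subset[OF _ fin]) auto
  show ?thesis unfolding cx_def
  proof (intro conjI allI)
    fix i
    show "pobj (fst (dsum X Y) i)" by (rule pobjI) (use d in \<open>auto simp: dsum_def block_simps\<close>)
    show "pmor (fst (dsum X Y) i) (fst (dsum X Y) (i + 1)) (snd (dsum X Y) i)"
      by (rule pmorI) (use d in \<open>auto simp: dsum_def block_simps\<close>)
    show "snd (dsum X Y) (i + 1) * snd (dsum X Y) i =
         0\<^sub>m (dim_row (fst (dsum X Y) (i + 2))) (dim_row (fst (dsum X Y) i))"
      using d by (auto simp: dsum_def block_simps add.assoc)
  qed (use fin fin' in \<open>auto simp: dsum_def\<close>)
qed

lemma cx_cone:
  assumes "cx X" "cx Y" "chm X Y f"
  shows "cx (cone X Y f)"
proof -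
  note d = cxD[OF assms(1)] cxD[OF assms(2)] cxD[OF assms(1), of "_ + 1"] chmD[OF assms(3)] chm_absorb[OF assms]
     chmD(2)[OF assms(3), of "_ + 1"]
  note D = cx_finite[OF cx_shiftc[OF assms(1)]] cx_finite[OF assms(2)]
  have "{i. dim_row (fst X (i + 1)) \<noteq> 0 \<or> dim_row (fst Y i) \<noteq> 0} =
    {i. dim_row (fst X (i + 1)) \<noteq> 0} \<union> {i. dim_row (fst Y i) \<noteq> 0}" by auto
  then have fin: "finite {i. dim_row (fst X (i + 1)) \<noteq> 0 \<or> dim_row (fst Y i) \<noteq> 0}" using D by (simp add: shiftc_def)
  have fin': "finite {i. dim_row (fst X (i + 1)) = 0 \<longrightarrow> 0 < dim_row (fst Y i)}"
    by (rule finite_subset[OF _ fin]) auto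
  show ?thesis unfolding cx_def
  proof (intro conjI allI)
    fix i
    show "pobj (fst (cone X Y f) i)" by (rule pobjI) (use d in \<open>auto simp: cone_def block_simps\<close>)
    show "pmor (fst (cone X Y f) i) (fst (cone X Y f) (i + 1)) (snd (cone X Y f) i)"
      by (rule pmorI) (use d in \<open>auto simp: cone_def block_simps add.assoc\<close>)
    show "snd (cone X Y f) (i + 1) * snd (cone X Y f) i =
         0\<^sub>m (dim_row (fst (cone X Y f) (i + 2))) (dim_row (fst (cone X Y f) i))"
      using d by (auto simp: cone_def block_simps add.assoc)
  qed (use fin fin' in \<open>auto simp: cone_def\<close>)
qed

lemma cinc_eq: "cinc X Y i = 0\<^sub>m (dim_row (fst X (i + 1))) (dim_row (fst Y i)) @\<^sub>r fst Y i"
  by (simp add: cinc_def append_rows_def)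

lemma cproj_eq: "cx X \<Longrightarrow> cproj X Y i = fst X (i + 1) @\<^sub>c 0\<^sub>m (dim_row (fst X (i + 1))) (dim_row (fst Y i))"
  by (simp add: cproj_def append_cols_def cxD)

lemma chm_cinc:
  assumes "cx X" "cx Y" "chm X Y f"
  shows "chm Y (cone X Y f) (cinc X Y)"
  using cxD[OF assms(1)] cxD[OF assms(2)] chmD[OF assms(3)]
  by (intro chmI) (auto simp: cinc_eq cone_def block_simps add.assoc)

lemma chm_cproj:
  assumes "cx X" "cx Y" "chm X Y f"
  shows "chm (cone X Y f) (shiftc X) (cproj X Y)"
  using cxD[OF assms(1)] cxD[OF assms(2)] chmD[OF assms(3)] cxD[OF assms(1), of "_ + 1"]
  by (intro chmI) (auto simp: cproj_eq[OF assms(1)] cone_def shiftc_def block_simps add.assoc)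

section \<open>Isomorphic arrows of the homotopy category have equal rank\<close>

lemma kisoD: "kiso X Y f \<Longrightarrow> chm X Y f" by (simp add: kiso_def)

lemma kiso_idc:
  assumes "cx X"
  shows "kiso X X (idc X)"
  unfolding kiso_def using chm_idc[OF assms] comp_idc(1)[OF assms assms chm_idc[OF assms]]
  by (auto intro!: exI[of _ "idc X"] htp_refl simp: assms)

text \<open>A single real coefficient of a rank. The locale serves both the constructed
  \<open>cx_rank\<close> and an arbitrary given rank function, one power of q at a time.\<close>

locale homotopy_rank =
  fixes R :: "'a::ring_1 cx \<Rightarrow> 'a cx \<Rightarrow> (int \<Rightarrow> 'a mat) \<Rightarrow> real"
  assumes R_htp: "cx X \<Longrightarrow> cx Y \<Longrightarrow> chm X Y f \<Longrightarrow> chm X Y g \<Longrightarrow> htp X Y f g \<Longrightarrow> R X Y f = R X Y g"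
    and R_comp: "cx X \<Longrightarrow> cx Y \<Longrightarrow> cx Z \<Longrightarrow> chm X Y f \<Longrightarrow> chm Y Z g \<Longrightarrow> R X Z (comp g f) \<le> R X Y f"
      "cx X \<Longrightarrow> cx Y \<Longrightarrow> cx Z \<Longrightarrow> chm X Y f \<Longrightarrow> chm Y Z g \<Longrightarrow> R X Z (comp g f) \<le> R Y Z g"
begin

text \<open>Up to homotopy \<open>f\<close> is \<open>b' b f\<close>, hence \<open>b' f' a\<close>,
  so it factors through \<open>f'\<close>; likewise \<open>f'\<close> is \<open>f' a a'\<close> and
  hence \<open>b f a'\<close>. Ranks do not increase under composition, so the two agree.\<close>

lemma R_iso:
  assumes cx: "cx X" "cx Y" "cx X'" "cx Y'" and f: "chm X Y f" and f': "chm X' Y' f'"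
    and a: "kiso X X' a" and b: "kiso Y Y' b" and sq: "htp X Y' (comp b f) (comp f' a)"
  shows "R X Y f = R X' Y' f'"
proof (rule antisym)
  note A = kisoD[OF a] and B = kisoD[OF b]
  obtain a' where a': "chm X' X a'" "htp X' X' (comp a a') (idc X')" using a by (auto simp: kiso_def)
  obtain b' where b': "chm Y' Y b'" "htp Y Y (comp b' b) (idc Y)" using b by (auto simp: kiso_def)
  have bf: "chm X Y' (comp b f)" and fa: "chm X Y' (comp f' a)"
    using A B cx f f' by (auto intro: chm_comp)
  have bb: "chm Y Y (comp b' b)" and aa: "chm X' X' (comp a a')"
    using A B cx a' b' by (auto intro: chm_comp)
  have "R X Y f = R X Y (comp (idc Y) f)" using cx f by (simp add: comp_idc)
  also have "\<dots> = R X Y (comp (comp b' b) f)"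
    by (rule R_htp[symmetric, OF cx(1,2) chm_comp[OF cx(1,2,2) f bb] chm_comp[OF cx(1,2,2) f chm_idc[OF cx(2)]]
          htp_comp_right[OF cx(1,2,2) f bb chm_idc[OF cx(2)] b'(2)]])
  also have "comp (comp b' b) f = comp b' (comp b f)" by (rule comp_assoc[OF f B b'(1)])
  also have "R X Y (comp b' (comp b f)) \<le> R X Y' (comp b f)" by (rule R_comp(1)) (use cx bf b' in auto)
  also have "\<dots> = R X Y' (comp f' a)" by (rule R_htp) (use cx bf fa sq in auto)
  also have "\<dots> \<le> R X' Y' f'" by (rule R_comp(2)) (use cx A f' in auto)
  finally show "R X Y f \<le> R X' Y' f'" .
  have "R X' Y' f' = R X' Y' (comp f' (idc X'))" using cx f' by (simp add: comp_idc)
  also have "\<dots> = R X' Y' (comp f' (comp a a'))"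
    by (rule R_htp[symmetric, OF cx(3,4) chm_comp[OF cx(3,3,4) aa f'] chm_comp[OF cx(3,3,4) chm_idc[OF cx(3)] f']
          htp_comp_left[OF cx(3,3,4) aa chm_idc[OF cx(3)] f' a'(2)]])
  also have "comp f' (comp a a') = comp (comp f' a) a'" by (rule comp_assoc[OF a'(1) A f', symmetric])
  also have "R X' Y' (comp (comp f' a) a') \<le> R X Y' (comp f' a)" by (rule R_comp(2)) (use cx fa a' in auto)
  also have "\<dots> = R X Y' (comp b f)" by (rule R_htp[symmetric]) (use cx bf fa sq in auto)
  also have "\<dots> \<le> R X Y f" by (rule R_comp(1)) (use cx B f in auto)
  finally show "R X' Y' f' \<le> R X Y f" .
qed

lemma R_iso_id:
  assumes "cx X" "cx X'" "kiso X X' a"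
  shows "R X X (idc X) = R X' X' (idc X')"
proof (rule R_iso[OF assms(1) assms(1) assms(2) assms(2) chm_idc chm_idc assms(3) assms(3)])
  have a: "chm X X' a" using assms(3) by (rule kisoD)
  show "htp X X' (comp a (idc X)) (comp (idc X') a)"
    using comp_idc[OF assms(1,2) a] htp_refl[OF assms(1,2) a] by simp
qed (use assms in auto)

text \<open>Transports the quantities in the triangle axiom to a cone triangle, where they can be
  computed.\<close>

lemma R_dtri:
  assumes "dtri X Y Z f g h"
  obtains X' Y' f' where "cx X'" "cx Y'" "chm X' Y' f'" "R X Y f = R X' Y' f'"
    "R Y Z g = R Y' (cone X' Y' f') (cinc X' Y')" "R Y Y (idc Y) = R Y' Y' (idc Y')"
proof -
  from assms obtain X' Y' f' a b c where *: "cx X" "cx Y" "cx Z" "chm X Y f" "chm Y Z g"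
    "cx X'" "cx Y'" "chm X' Y' f'" "kiso X X' a" "kiso Y Y' b" "kiso Z (cone X' Y' f') c"
    "htp X Y' (comp b f) (comp f' a)" "htp Y (cone X' Y' f') (comp c g) (comp (cinc X' Y') b)"
    unfolding dtri_def by auto
  show ?thesis
  proof (rule that)
    show "R Y Z g = R Y' (cone X' Y' f') (cinc X' Y')"
      by (rule R_iso[OF _ _ _ _ _ _ *(10,11,13)]) (use * in \<open>auto intro: cx_cone chm_cinc\<close>)
    show "R X Y f = R X' Y' f'" by (rule R_iso[OF _ _ _ _ _ _ *(9,10,12)]) (use * in auto)
    show "R Y Y (idc Y) = R Y' Y' (idc Y')" by (rule R_iso_id) (use * in auto)
  qed (use * in auto)
qed

end

section \<open>Extending a Sylvester rank function to complexes\<close>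

context mat_rank
begin

lemma rank_lower_inclusion:
  assumes "dim_col dY = n" "dim_row e = n" "dim_col e = n" "e * e = e" "dY * e = dY"
    "dim_row f = n" "dim_col f = dim_col dX" "e * f = f" "dY * f = f' * dX"
    "dim_row f' = dim_row dY" "dim_col f' = dim_row dX"
    "dim_row d = n" "e * d = d" "dY * d = 0\<^sub>m (dim_row dY) (dim_col d)"
  shows "r (lower dY (0\<^sub>m (dim_row dX) n @\<^sub>r e)
     (four_block_mat (- dX) (0\<^sub>m (dim_row dX) (dim_col d)) f d)) = r dX + r e" (is "r ?L = _")
proof -
  let ?x1 = "dim_row dX" and ?x0 = "dim_col dX" and ?y1 = "dim_row dY" and ?y = "dim_col d"
  have "r ?L \<le> r (bdiag dX e)"
    by (rule rank_le_conj[where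
        P = "four_block_mat (- f') dY (- 1\<^sub>m ?x1 @\<^sub>r 0\<^sub>m n ?x1) (0\<^sub>m ?x1 n @\<^sub>r 1\<^sub>m n)"
        and Q = "four_block_mat (0\<^sub>m ?x0 n) (1\<^sub>m ?x0 @\<^sub>c 0\<^sub>m ?x0 ?y) (1\<^sub>m n) (f @\<^sub>c d)"])
      (use assms in \<open>auto simp: block_simps lower_def\<close>)
  moreover have "r (bdiag dX e) \<le> r ?L"
    by (rule rank_le_conj[where
        P = "four_block_mat (0\<^sub>m ?x1 ?y1) (- 1\<^sub>m ?x1 @\<^sub>c 0\<^sub>m ?x1 n) (0\<^sub>m n ?y1) (0\<^sub>m n ?x1 @\<^sub>c 1\<^sub>m n)"
        and Q = "four_block_mat (- f) (1\<^sub>m n) (1\<^sub>m ?x0 @\<^sub>r 0\<^sub>m ?y ?x0) (0\<^sub>m (?x0 + ?y) n)"])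
      (use assms in \<open>auto simp: block_simps lower_def\<close>)
  ultimately show ?thesis by (simp add: rank_bdiag)
qed

text \<open>The case \<open>X = 0\<close>, in which the inclusion into the cone is the identity of
  \<open>Y\<close>.\<close>

lemma rank_lower_id:
  assumes "dim_col dY = n" "dim_row e = n" "dim_col e = n" "e * e = e" "dY * e = dY"
    "dim_row d = n" "e * d = d" "dY * d = 0\<^sub>m (dim_row dY) (dim_col d)"
  shows "r (lower dY e d) = r e"
proof -
  have "0\<^sub>m 0 n @\<^sub>r e = e" "four_block_mat (0\<^sub>m 0 0) (0\<^sub>m 0 (dim_col d)) (0\<^sub>m n 0) d = d"
    using assms by (simp_all add: append_rows_def degenerate_four_block)
  then show ?thesis
    using rank_lower_inclusion[of dY n e "0\<^sub>m n 0" "0\<^sub>m 0 0" "0\<^sub>m (dim_row dY) 0" d] assms by simp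
qed

text \<open>The differential of the cone of \<open>f\<close> is, up to the sign of one row, the
  matrix that defines the cohomological rank of \<open>f\<close>.\<close>

lemma rank_cone_differential:
  assumes "dim_row f = dim_row d'" "dim_col f = dim_col d"
  shows "r (four_block_mat (- d) (0\<^sub>m (dim_row d) (dim_col d')) f d') = r (lower d f d')"
proof -
  have *: "r (lower (- d) f d') \<le> r (lower d f d')"
    if d: "dim_row f = dim_row d'" "dim_col f = dim_col d" for d d' f
    by (rule rank_le_conj[where
        P = "four_block_mat (- 1\<^sub>m (dim_row d)) (0\<^sub>m (dim_row d) (dim_row d')) (0\<^sub>m (dim_row d') (dim_row d)) (1\<^sub>m (dim_row d'))"
        and Q = "1\<^sub>m (dim_col d + dim_col d')"])
      (use d in \<open>auto simp: block_simps lower_def\<close>)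
  from *[of f d' d] *[of f d' "- d"] assms show ?thesis by (simp add: lower_def)
qed

text \<open>The rank of the cone differential is the leading term for \<open>f\<close> and a
  subtracted term for the inclusion, so it cancels. The ranks of \<open>dX\<close> cancel too,
  leaving \<open>r e - r dY - r d\<close>.\<close>

lemma coh_rank_triangle:
  assumes "dim_col dY = n" "dim_row e = n" "dim_col e = n" "e * e = e" "dY * e = dY"
    "dim_row f = n" "dim_col f = dim_col dX" "e * f = f" "dY * f = f' * dX"
    "dim_row f' = dim_row dY" "dim_col f' = dim_row dX"
    "dim_row d = n" "e * d = d" "dY * d = 0\<^sub>m (dim_row dY) (dim_col d)"
  shows "coh_rank dX f d + coh_rank dY (0\<^sub>m (dim_row dX) n @\<^sub>r e)
     (four_block_mat (- dX) (0\<^sub>m (dim_row dX) (dim_col d)) f d) = coh_rank dY e d"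
  using rank_lower_inclusion[OF assms] rank_lower_id[of dY n e d] rank_cone_differential[of f d dX] assms
  by (simp add: coh_rank_def)

text \<open>Without source columns the matrix is \<open>d'\<close> below zero rows. This is what
  gives \<open>cx_rank\<close> finite support.\<close>

lemma coh_rank_0_source:
  assumes "dim_row f = dim_row d'" "dim_col f = dim_col d" "dim_col d = 0"
  shows "coh_rank d f d' = 0"
proof -
  have "r (lower d f d') \<le> r d'"
  proof (rule rank_le_conj[where P = "0\<^sub>m (dim_row d) (dim_row d') @\<^sub>r 1\<^sub>m (dim_row d')" and Q = "1\<^sub>m (dim_col d')"])
    have "lower d f d' = 0\<^sub>m (dim_row d) (dim_col d') @\<^sub>r d'"
      using assms by (auto simp: lower_def append_rows_def intro!: eq_matI)
    then show "lower d f d' = (0\<^sub>m (dim_row d) (dim_row d') @\<^sub>r 1\<^sub>m (dim_row d')) * d' * 1\<^sub>m (dim_col d')"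
      by (simp add: append_mult)
  qed auto
  with rank_lower[of f d' d] coh_rank_nonneg[of f d' d] nonneg[of d] assms show ?thesis
    by (simp add: coh_rank_def)
qed

text \<open>The sign of the exponent makes the shift \<open>(\<Sigma>X)\<^sup>i = X\<^sup>i\<^sup>+\<^sup>1\<close> act as multiplication by \<open>q\<close>.\<close>

definition cx_rank :: "'a cx \<Rightarrow> 'a cx \<Rightarrow> (int \<Rightarrow> 'a mat) \<Rightarrow> int \<Rightarrow> real" where
  "cx_rank X Y f n = coh_rank (snd X (- n)) (f (- n)) (snd Y (- n - 1))"

section \<open>The axioms for the extended rank function\<close>

lemma Rpos_cx_rank:
  assumes "cx X" "cx Y" "chm X Y f"
  shows "Rpos \<infinity> (cx_rank X Y f)"
proof -
  note d = cxD[OF assms(1)] cx_prevD[OF assms(2)] chmD[OF assms(3)]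
  have "{n. cx_rank X Y f n \<noteq> 0} \<subseteq> uminus ` {i. dim_row (fst X i) \<noteq> 0}"
  proof
    fix n assume "n \<in> {n. cx_rank X Y f n \<noteq> 0}"
    then have n: "cx_rank X Y f n \<noteq> 0" by simp
    have "dim_row (fst X (- n)) \<noteq> 0"
    proof
      assume "dim_row (fst X (- n)) = 0"
      then have "coh_rank (snd X (- n)) (f (- n)) (snd Y (- n - 1)) = 0"
        by (intro coh_rank_0_source) (use d in auto)
      with n show False by (simp add: cx_rank_def)
    qed
    then show "n \<in> uminus ` {i. dim_row (fst X i) \<noteq> 0}" by (intro image_eqI[of _ _ "- n"]) auto
  qed
  then have "finite {n. cx_rank X Y f n \<noteq> 0}"
    by (rule finite_subset) (use cx_finite[OF assms(1)] in auto)
  moreover have "0 \<le> cx_rank X Y f n" for n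
    unfolding cx_rank_def by (rule coh_rank_nonneg) (use d in auto)
  ultimately show ?thesis by (simp add: Rpos_def Rd_def)
qed

lemma Rle_infinity:
  assumes "Rpos \<infinity> phi" "Rpos \<infinity> psi" "\<And>n. psi n \<le> phi n"
  shows "Rle \<infinity> psi phi"
proof -
  have "finite {n. phi n - psi n \<noteq> 0}"
    by (rule finite_subset[of _ "{n. phi n \<noteq> 0} \<union> {n. psi n \<noteq> 0}"]) (use assms in \<open>auto simp: Rpos_def Rd_def\<close>)
  with assms show ?thesis by (auto simp: Rle_def Rpos_def Rd_def)
qed

lemma Rpos_Radd:
  assumes "Rpos \<infinity> phi" "Rpos \<infinity> psi"
  shows "Rpos \<infinity> (Radd phi psi)"
proof -
  have "finite {n. phi n + psi n \<noteq> 0}"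
    by (rule finite_subset[of _ "{n. phi n \<noteq> 0} \<union> {n. psi n \<noteq> 0}"]) (use assms in \<open>auto simp: Rpos_def Rd_def\<close>)
  with assms show ?thesis by (auto simp: Radd_def Rpos_def Rd_def)
qed

lemma cx_rank_htp:
  assumes "cx X" "cx Y" "chm X Y f" "chm X Y g" "htp X Y f g"
  shows "cx_rank X Y f n = cx_rank X Y g n"
proof -
  obtain h where h: "\<And>i. pmor (fst X i) (fst Y (i - 1)) (h i)"
    "\<And>i. f i - g i = snd Y (i - 1) * h i + h (i + 1) * snd X i"
    using assms(5) by (auto simp: htp_def)
  define i where "i = - n"
  note d = cxD[OF assms(1)] cxD[OF assms(2)] cx_prevD[OF assms(2)] chmD[OF assms(3)] chmD[OF assms(4)]
    pmorD[OF h(1)] pmorD[OF h(1)[of "i + 1"]]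
  have "f i = g i + (f i - g i)" by (rule eq_matI) (use d in auto)
  also have "\<dots> = g i + (snd Y (i - 1) * h i + h (i + 1) * snd X i)" by (simp only: h(2))
  finally have "coh_rank (snd X i) (f i) (snd Y (i - 1)) =
    coh_rank (snd X i) (g i + (snd Y (i - 1) * h i + h (i + 1) * snd X i)) (snd Y (i - 1))" by simp
  also have "\<dots> = coh_rank (snd X i) (g i) (snd Y (i - 1))"
    by (rule coh_rank_homotopy) (use d in auto)
  finally show ?thesis by (simp add: cx_rank_def i_def)
qed

lemma cx_rank_comp:
  assumes "cx X" "cx Y" "cx Z" "chm X Y f" "chm Y Z g"
  shows "cx_rank X Z (comp g f) n \<le> cx_rank X Y f n" "cx_rank X Z (comp g f) n \<le> cx_rank Y Z g n"
proof -
  note d = cxD[OF assms(1)] cxD[OF assms(2)] cxD[OF assms(3)] cx_prevD[OF assms(2)] cx_prevD[OF assms(3)]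
    chmD[OF assms(4)] chmD[OF assms(5)]
  show "cx_rank X Z (comp g f) n \<le> cx_rank X Y f n"
    unfolding cx_rank_def comp_def
    by (rule coh_rank_comp_right[where g' = "g (- n - 1)"]) (use d chmD(2)[OF assms(5), of "- n - 1"] in auto)
  show "cx_rank X Z (comp g f) n \<le> cx_rank Y Z g n"
    unfolding cx_rank_def comp_def
    by (rule coh_rank_comp_left[where f' = "f (- n + 1)"]) (use d in auto)
qed

lemma homotopy_rank_cx_rank: "homotopy_rank (\<lambda>X Y f. cx_rank X Y f n)"
  by standard (auto intro: cx_rank_htp cx_rank_comp)

lemma cx_rank_cone:
  assumes "cx X" "cx Y" "chm X Y f"
  shows "cx_rank X Y f n + cx_rank Y (cone X Y f) (cinc X Y) n = cx_rank Y Y (idc Y) n"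
proof -
  define i where "i = - n"
  note d = cxD[OF assms(1)] cxD[OF assms(2)] cx_prevD[OF assms(2)] chmD[OF assms(3)] chm_absorb[OF assms]
  have "coh_rank (snd X i) (f i) (snd Y (i - 1)) + coh_rank (snd Y i) (0\<^sub>m (dim_row (snd X i)) (dim_row (fst Y i)) @\<^sub>r fst Y i)
     (four_block_mat (- snd X i) (0\<^sub>m (dim_row (snd X i)) (dim_col (snd Y (i - 1)))) (f i) (snd Y (i - 1))) =
     coh_rank (snd Y i) (fst Y i) (snd Y (i - 1))"
    by (rule coh_rank_triangle[where f' = "f (i + 1)"]) (use d in auto)
  moreover have "dim_col (snd Y (i - 1)) = dim_row (fst Y (i - 1))" "i - 1 + 2 = i + 1" using d by auto
  ultimately show ?thesis using d by (simp add: cx_rank_def idc_def cinc_eq cone_def i_def)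
qed

lemma rank_fn_cx_rank: "rank_fn \<infinity> cx_rank"
  unfolding rank_fn_def
proof (intro conjI allI impI; (elim conjE)?)
  fix X Y :: "'a cx" and f assume *: "cx X" "cx Y" "chm X Y f"
  show "Rpos \<infinity> (cx_rank X Y f)" by (rule Rpos_cx_rank) fact+
  show "cx_rank (shiftc X) (shiftc Y) (shiftm f) = qmul (cx_rank X Y f)"
  proof
    fix n
    \<comment> \<open>Degree \<open>- n\<close> of the shift is degree
      \<open>1 - n = - (n - 1)\<close> of the complex, which matches the coefficient read by
      \<open>qmul\<close>.\<close>
    have "coh_rank (- snd X (1 - n)) (f (1 - n)) (- snd Y (- n)) = coh_rank (snd X (1 - n)) (f (1 - n)) (snd Y (- n))"
      by (rule coh_rank_uminus)
        (use cxD[OF *(1)] cxD[OF *(2)] cx_prevD[OF *(2), of "1 - n"] chmD[OF *(3)] in auto)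
    then show "cx_rank (shiftc X) (shiftc Y) (shiftm f) n = qmul (cx_rank X Y f) n"
      by (simp add: cx_rank_def shiftc_def shiftm_def qmul_def)
  qed
  fix g assume **: "chm X Y g" "htp X Y f g"
  show "cx_rank X Y f = cx_rank X Y g" by (rule ext, rule cx_rank_htp) fact+
next
  fix X Y Z W :: "'a cx" and f g assume *: "cx X" "cx Y" "cx Z" "cx W" "chm X Y f" "chm Z W g"
  note d = cxD[OF *(1)] cxD[OF *(2)] cxD[OF *(3)] cxD[OF *(4)] cx_prevD[OF *(2)] cx_prevD[OF *(4)]
    chmD[OF *(5)] chmD[OF *(6)]
  show "cx_rank (dsum X Z) (dsum Y W) (msum f g) = Radd (cx_rank X Y f) (cx_rank Z W g)"
    unfolding cx_rank_def dsum_def msum_def Radd_def snd_conv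
    by (rule ext, rule coh_rank_bdiag) (use d in auto)
  fix h assume h: "chm Z Y h"
  have le: "Radd (cx_rank X Y f) (cx_rank Z W g) n \<le> cx_rank (dsum X Z) (dsum Y W) (mutri f h g) n" for n
    unfolding cx_rank_def dsum_def mutri_def Radd_def snd_conv
    by (rule coh_rank_utri) (use d chmD[OF h] in auto)
  have "chm (dsum X Z) (dsum Y W) (mutri f h g)"
    using d chmD[OF h] chm_absorb[OF *(1,2,5)] chm_absorb[OF *(3,4,6)] chm_absorb[OF *(3,2) h]
    by (intro chmI) (auto simp: dsum_def mutri_def block_simps)
  then show "Rle \<infinity> (Radd (cx_rank X Y f) (cx_rank Z W g)) (cx_rank (dsum X Z) (dsum Y W) (mutri f h g))"
    by (intro Rle_infinity le Rpos_Radd Rpos_cx_rank cx_dsum *)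
next
  fix X Y Z :: "'a cx" and f g h assume *: "dtri X Y Z f g h"
  show "Radd (cx_rank X Y f) (cx_rank Y Z g) = cx_rank Y Y (idc Y)"
  proof
    fix n
    interpret homotopy_rank "\<lambda>X Y f. cx_rank X Y f n" by (rule homotopy_rank_cx_rank)
    show "Radd (cx_rank X Y f) (cx_rank Y Z g) n = cx_rank Y Y (idc Y) n"
      by (rule R_dtri[OF *]) (simp add: Radd_def cx_rank_cone)
  qed
next
  fix X Y Z :: "'a cx" and f g assume *: "cx X" "cx Y" "cx Z" "chm X Y f" "chm Y Z g"
  show "Rle \<infinity> (cx_rank X Z (comp g f)) (cx_rank X Y f)"
    by (intro Rle_infinity Rpos_cx_rank cx_rank_comp *) (use * in \<open>auto intro: chm_comp\<close>)
  show "Rle \<infinity> (cx_rank X Z (comp g f)) (cx_rank Y Z g)"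
    by (intro Rle_infinity Rpos_cx_rank cx_rank_comp *) (use * in \<open>auto intro: chm_comp\<close>)
qed

text \<open>In degree 0 both differentials have a vanishing dimension, so the block matrix collapses
  to \<open>f\<close>. In the other degrees every matrix lacks rows or columns.\<close>

lemma cx_rank_conc0:
  assumes "pmor e e' f"
  shows "cx_rank (conc0 e) (conc0 e') (conc0m f) = rconst \<infinity> (r f)"
proof
  fix n
  have "lower (0\<^sub>m 0 (dim_row e)) f (0\<^sub>m (dim_row e') 0) = f"
    using pmorD[OF assms] by (simp add: lower_def degenerate_four_block)
  moreover have "lower (0\<^sub>m 0 0) (0\<^sub>m 0 0) (0\<^sub>m 0 k) = 0\<^sub>m 0 k" "lower (0\<^sub>m k 0) (0\<^sub>m 0 0) (0\<^sub>m 0 0) = 0\<^sub>m k 0" for k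
    by (simp_all add: lower_def)
  ultimately show "cx_rank (conc0 e) (conc0 e') (conc0m f) n = rconst \<infinity> (r f) n"
    by (auto simp: cx_rank_def conc0_def conc0m_def rconst_def coh_rank_def)
qed

end

section \<open>Matrix ranks from Sylvester rank functions\<close>

lemma pobj_1 [simp]: "pobj (1\<^sub>m n)" by (simp add: pobj_def)

lemma pmor_1 [simp]: "dim_row f = m \<Longrightarrow> dim_col f = n \<Longrightarrow> pmor (1\<^sub>m n) (1\<^sub>m m) f"
  by (rule pmorI) auto

lemma bdiag_1: "bdiag (1\<^sub>m n) (1\<^sub>m m) = 1\<^sub>m (n + m)"
  by (simp add: bdiag_def)

definition free_rank :: "('a::ring_1 mat \<Rightarrow> 'a mat \<Rightarrow> 'a mat \<Rightarrow> real) \<Rightarrow> 'a mat \<Rightarrow> real" where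
  "free_rank s f = s (1\<^sub>m (dim_col f)) (1\<^sub>m (dim_row f)) f"

lemma sylvesterD:
  assumes "sylvester s"
  shows "pobj e \<Longrightarrow> pobj e' \<Longrightarrow> pmor e e' f \<Longrightarrow> 0 \<le> s e e' f"
    and "s (1\<^sub>m 1) (1\<^sub>m 1) (1\<^sub>m 1) = 1"
    and "pobj e1 \<Longrightarrow> pobj e2 \<Longrightarrow> pobj e3 \<Longrightarrow> pobj e4 \<Longrightarrow> pmor e1 e2 f \<Longrightarrow> pmor e3 e4 g \<Longrightarrow>
        s (bdiag e1 e3) (bdiag e2 e4) (bdiag f g) = s e1 e2 f + s e3 e4 g"
    and "pobj e1 \<Longrightarrow> pobj e2 \<Longrightarrow> pobj e3 \<Longrightarrow> pobj e4 \<Longrightarrow> pmor e1 e2 f \<Longrightarrow> pmor e3 e4 g \<Longrightarrow> pmor e3 e2 h \<Longrightarrow>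
        s e1 e2 f + s e3 e4 g \<le> s (bdiag e1 e3) (bdiag e2 e4) (utri f h g)"
    and "pobj e1 \<Longrightarrow> pobj e2 \<Longrightarrow> pobj e3 \<Longrightarrow> pmor e1 e2 f \<Longrightarrow> pmor e2 e3 g \<Longrightarrow> s e1 e3 (g * f) \<le> s e1 e2 f"
    and "pobj e1 \<Longrightarrow> pobj e2 \<Longrightarrow> pobj e3 \<Longrightarrow> pmor e1 e2 f \<Longrightarrow> pmor e2 e3 g \<Longrightarrow> s e1 e3 (g * f) \<le> s e2 e3 g"
  using assms unfolding sylvester_def by auto

lemma mat_rank_free_rank:
  assumes "sylvester s"
  shows "mat_rank (free_rank s)"
proof
  fix A B C :: "'a mat"
  show "0 \<le> free_rank s A" unfolding free_rank_def by (rule sylvesterD(1)[OF assms]) auto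
  show "free_rank s (bdiag A B) = free_rank s A + free_rank s B"
    unfolding free_rank_def dim_bdiag bdiag_1[symmetric] by (rule sylvesterD(3)[OF assms]) auto
  show "free_rank s A + free_rank s B \<le> free_rank s (utri A C B)"
    if "dim_row C = dim_row A" "dim_col C = dim_col B"
    unfolding free_rank_def dim_utri bdiag_1[symmetric] by (rule sylvesterD(4)[OF assms]) (use that in auto)
  show "free_rank s (A * B) \<le> free_rank s A" "free_rank s (A * B) \<le> free_rank s B"
    if "dim_col A = dim_row B"
    using that sylvesterD(5,6)[OF assms, of "1\<^sub>m (dim_col B)" "1\<^sub>m (dim_row B)" "1\<^sub>m (dim_row A)" B A]
    by (simp_all add: free_rank_def)
qed

text \<open>\<open>f\<close> and its underlying matrix factor through each other via the idempotents \<open>e\<close> and \<open>e'\<close>.\<close>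

lemma sylvester_eq_free_rank:
  assumes "sylvester s" "pobj e" "pobj e'" "pmor e e' f"
  shows "s e e' f = free_rank s f"
proof -
  let ?I = "1\<^sub>m (dim_row e)" and ?J = "1\<^sub>m (dim_row e')"
  note d = pobjD[OF assms(2)] pobjD[OF assms(3)] pmorD[OF assms(4)] pmor_absorb[OF assms(4,2,3)]
  have pm: "pmor ?I e e" "pmor e ?I e" "pmor ?J e' e'" "pmor e' ?J e'" "pmor e ?J f" "pmor ?I e' f"
    by (rule pmorI; use d in simp)+
  have "s e e' (e' * f) \<le> s e ?J f" by (rule sylvesterD(5)[OF assms(1)]) (use assms pm in auto)
  moreover have "s e ?J (f * e) \<le> s ?I ?J f" by (rule sylvesterD(6)[OF assms(1)]) (use assms pm d in auto)
  moreover have "s ?I ?J (e' * f) \<le> s ?I e' f" by (rule sylvesterD(5)[OF assms(1)]) (use assms pm in auto)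
  moreover have "s ?I e' (f * e) \<le> s e e' f" by (rule sylvesterD(6)[OF assms(1)]) (use assms pm in auto)
  ultimately show ?thesis using d by (simp add: free_rank_def)
qed

lemma idc_conc0: "idc (conc0 e) = conc0m e"
  by (auto simp: idc_def conc0_def conc0m_def)

lemma sylvester_extends:
  assumes "sylvester s"
  shows "\<exists>rho. rank_fn \<infinity> rho \<and> normalized \<infinity> rho \<and>
    (\<forall>e e' f. pobj e \<and> pobj e' \<and> pmor e e' f \<longrightarrow>
       rho (conc0 e) (conc0 e') (conc0m f) = rconst \<infinity> (s e e' f))"
proof -
  interpret mat_rank "free_rank s" by (rule mat_rank_free_rank) fact
  have "\<forall>e e' f. pobj e \<and> pobj e' \<and> pmor e e' f \<longrightarrow>
       cx_rank (conc0 e) (conc0 e') (conc0m f) = rconst \<infinity> (s e e' f)"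
    using sylvester_eq_free_rank[OF assms] by (auto simp: cx_rank_conc0)
  moreover from this have "normalized \<infinity> cx_rank"
    by (simp add: normalized_def idc_conc0 sylvesterD(2)[OF assms] del: One_nat_def)
  ultimately show ?thesis using rank_fn_cx_rank by blast
qed

section \<open>Restricting a rank function to projective modules\<close>

text \<open>Attaching the terms of a complex one by one needs modules placed in arbitrary
  degrees.\<close>

definition concd :: "int \<Rightarrow> 'a::ring_1 mat \<Rightarrow> 'a cx" where
  "concd k e = (\<lambda>i. if i = k then e else 0\<^sub>m 0 0,
              \<lambda>i. 0\<^sub>m (if i = k - 1 then dim_row e else 0) (if i = k then dim_row e else 0))"

definition concm :: "int \<Rightarrow> 'a::ring_1 mat \<Rightarrow> int \<Rightarrow> 'a mat" where
  "concm k f = (\<lambda>i. if i = k then f else 0\<^sub>m 0 0)"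

lemma conc0_eq: "conc0 e = concd 0 e" "conc0m f = concm 0 f"
  by (simp_all add: conc0_def concd_def conc0m_def concm_def)

lemma idc_concd: "idc (concd k e) = concm k e"
  by (auto simp: idc_def concd_def concm_def)

lemma cx_concd:
  assumes "pobj e"
  shows "cx (concd k e)"
proof -
  have "finite {i. dim_row (fst (concd k e) i) \<noteq> 0}"
    by (rule finite_subset[of _ "{k}"]) (auto simp: concd_def split: if_splits)
  then show ?thesis using assms pobjD[OF assms]
    by (auto simp: cx_def concd_def intro!: pobjI pmorI)
qed

lemma chm_concm: "pobj e \<Longrightarrow> pobj e' \<Longrightarrow> pmor e e' f \<Longrightarrow> chm (concd k e) (concd k e') (concm k f)"
  by (rule chmI) (auto simp: concd_def concm_def pmorD pmor_absorb)

lemma shift_concd: "shiftc (concd k e) = concd (k - 1) e" "shiftm (concm k f) = concm (k - 1) f"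
  by (auto simp: shiftc_def concd_def shiftm_def concm_def fun_eq_iff)

lemma dsum_concd: "pobj e \<Longrightarrow> pobj e' \<Longrightarrow> dsum (concd k e) (concd k e') = concd k (bdiag e e')"
  by (auto simp: dsum_def concd_def fun_eq_iff bdiag_def pobjD)

lemma msum_concm: "msum (concm k f) (concm k g) = concm k (bdiag f g)"
  "mutri (concm k f) (concm k h) (concm k g) = concm k (utri f h g)"
  by (auto simp: msum_def mutri_def concm_def fun_eq_iff bdiag_def utri_def)

lemma comp_concm: "comp (concm k g) (concm k f) = concm k (g * f)"
  by (auto simp: comp_def concm_def fun_eq_iff)

lemma dtriI:
  assumes "cx X" "cx Y" "cx Z" "chm X Y f" "chm Y Z g" "chm Z (shiftc X) h"
    "cx X'" "cx Y'" "chm X' Y' f'" "kiso X X' a" "kiso Y Y' b" "kiso Z (cone X' Y' f') c"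
    "htp X Y' (comp b f) (comp f' a)" "htp Y (cone X' Y' f') (comp c g) (comp (cinc X' Y') b)"
    "htp Z (shiftc X') (comp (shiftm a) h) (comp (cproj X' Y') c)"
  shows "dtri X Y Z f g h"
  unfolding dtri_def using assms by blast

lemma shiftm_idc: "shiftm (idc X) = idc (shiftc X)"
  by (simp add: shiftm_def idc_def shiftc_def)

lemma dtri_cone:
  assumes "cx X" "cx Y" "chm X Y f"
  shows "dtri X Y (cone X Y f) f (cinc X Y) (cproj X Y)"
proof -
  note c = assms cx_cone[OF assms] cx_shiftc[OF assms(1)] chm_cinc[OF assms] chm_cproj[OF assms]
  show ?thesis
    by (rule dtriI[OF assms(1,2) _ _ _ _ assms kiso_idc kiso_idc kiso_idc])
      (simp_all add: c comp_idc[OF c(1,2,3)] comp_idc[OF c(2,4,6)] comp_idc[OF c(4,5,7)] shiftm_idc htp_refl)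
qed

section \<open>Coefficientwise consequences of the axioms\<close>

locale rank_function =
  fixes d :: enat and rho :: "'a::ring_1 cx \<Rightarrow> 'a cx \<Rightarrow> (int \<Rightarrow> 'a mat) \<Rightarrow> int \<Rightarrow> real"
  assumes rank_fn: "rank_fn d rho"
begin

lemmas rank_fn_axioms = rank_fn[unfolded rank_fn_def]

lemma rho_Rpos: "cx X \<Longrightarrow> cx Y \<Longrightarrow> chm X Y f \<Longrightarrow> Rpos d (rho X Y f)"
  by (rule rank_fn_axioms[THEN conjunct1, rule_format]) simp

lemma rho_nonneg: "cx X \<Longrightarrow> cx Y \<Longrightarrow> chm X Y f \<Longrightarrow> 0 \<le> rho X Y f n"
  using rho_Rpos by (auto simp: Rpos_def)

lemma rho_htp: "cx X \<Longrightarrow> cx Y \<Longrightarrow> chm X Y f \<Longrightarrow> chm X Y g \<Longrightarrow> htp X Y f g \<Longrightarrow> rho X Y f = rho X Y g"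
  by (rule rank_fn_axioms[THEN conjunct2, THEN conjunct1, rule_format]) simp

lemma rho_shift:
  assumes "cx X" "cx Y" "chm X Y f"
  shows "rho (shiftc X) (shiftc Y) (shiftm f) n = rho X Y f (n - 1)"
  using rank_fn_axioms[THEN conjunct2, THEN conjunct2, THEN conjunct1, rule_format, of X Y f] assms
  by (simp add: qmul_def)

lemma rho_dsum:
  assumes "cx X" "cx Y" "cx Z" "cx W" "chm X Y f" "chm Z W g"
  shows "rho (dsum X Z) (dsum Y W) (msum f g) n = rho X Y f n + rho Z W g n"
  using rank_fn_axioms[THEN conjunct2, THEN conjunct2, THEN conjunct2, THEN conjunct1, rule_format, of X Y Z W f g] assms
  by (simp add: Radd_def)

lemma rho_dtri:
  assumes "dtri X Y Z f g h"
  shows "rho X Y f n + rho Y Z g n = rho Y Y (idc Y) n"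
  using fun_cong[OF rank_fn_axioms[THEN conjunct2, THEN conjunct2, THEN conjunct2, THEN conjunct2, THEN conjunct1,
      rule_format, OF assms], of n]
  by (simp add: Radd_def)

lemma rho_mutri:
  assumes "cx X" "cx Y" "cx Z" "cx W" "chm X Y f" "chm Z W g" "chm Z Y h"
  shows "rho X Y f n + rho Z W g n \<le> rho (dsum X Z) (dsum Y W) (mutri f h g) n"
  using rank_fn_axioms[THEN conjunct2, THEN conjunct2, THEN conjunct2, THEN conjunct2, THEN conjunct2, THEN conjunct1,
      rule_format, of X Y Z W f g h] assms
  by (simp add: Rle_def Rpos_def Radd_def)

lemma rho_comp:
  assumes "cx X" "cx Y" "cx Z" "chm X Y f" "chm Y Z g"
  shows "rho X Z (comp g f) n \<le> rho X Y f n" "rho X Z (comp g f) n \<le> rho Y Z g n"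
  using rank_fn_axioms[THEN conjunct2, THEN conjunct2, THEN conjunct2, THEN conjunct2, THEN conjunct2, THEN conjunct2,
      rule_format, of X Y Z f g] assms
  by (simp_all add: Rle_def Rpos_def)

sublocale homotopy_rank "\<lambda>X Y f. rho X Y f n" for n
  by standard (auto intro: rho_comp simp: rho_htp)

lemma rho_le_id:
  assumes "cx X" "cx Y" "chm X Y f"
  shows "rho X Y f n \<le> rho X X (idc X) n" "rho X Y f n \<le> rho Y Y (idc Y) n"
  using rho_comp(1)[OF assms(1,1,2) chm_idc[OF assms(1)] assms(3), of n]
    rho_comp(2)[OF assms(1,2,2) assms(3) chm_idc[OF assms(2)], of n]
  by (simp_all add: comp_idc[OF assms])

lemma rho_0: "rho (concd k (0\<^sub>m 0 0)) (concd k (0\<^sub>m 0 0)) (concm k (0\<^sub>m 0 0)) n = 0"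
proof -
  have p: "pobj (0\<^sub>m 0 0 :: 'a mat)" "pmor (0\<^sub>m 0 0) (0\<^sub>m 0 0) (0\<^sub>m 0 0 :: 'a mat)"
    by (auto intro: pobjI pmorI)
  have b: "bdiag (0\<^sub>m 0 0) (0\<^sub>m 0 0) = (0\<^sub>m 0 0 :: 'a mat)" by (simp add: bdiag_def)
  show ?thesis
    using rho_dsum[of "concd k (0\<^sub>m 0 0)" "concd k (0\<^sub>m 0 0)" "concd k (0\<^sub>m 0 0)" "concd k (0\<^sub>m 0 0)" "concm k (0\<^sub>m 0 0)" "concm k (0\<^sub>m 0 0)" n]
    by (simp add: cx_concd chm_concm p dsum_concd msum_concm b)
qed

end

locale normalized_rank_function = rank_function +
  assumes normalized: "normalized d rho"
begin

lemma rho_free: "rho (conc0 (1\<^sub>m n)) (conc0 (1\<^sub>m n)) (conc0m (1\<^sub>m n)) m = real n * rconst d 1 m"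
proof (induction n)
  case 0
  have "1\<^sub>m 0 = (0\<^sub>m 0 0 :: 'a mat)" by (rule eq_matI) auto
  then show ?case using rho_0[of 0 m] by (simp add: conc0_eq)
next
  case (Suc n)
  have "bdiag (1\<^sub>m n) (1\<^sub>m 1) = (1\<^sub>m (Suc n) :: 'a mat)" by (simp add: bdiag_def)
  moreover have "rho (conc0 (1\<^sub>m 1)) (conc0 (1\<^sub>m 1)) (conc0m (1\<^sub>m 1)) m = rconst d 1 m"
    using normalized by (simp add: normalized_def conc0_eq idc_concd)
  moreover have "pobj (1\<^sub>m k :: 'a mat)" "pmor (1\<^sub>m k) (1\<^sub>m k) (1\<^sub>m k :: 'a mat)" for k
    by (auto intro: pobjI pmorI)
  ultimately show ?case
    using rho_dsum[of "concd 0 (1\<^sub>m n)" "concd 0 (1\<^sub>m n)" "concd 0 (1\<^sub>m 1)" "concd 0 (1\<^sub>m 1)" "concm 0 (1\<^sub>m n)" "concm 0 (1\<^sub>m 1)" m] Suc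
    by (simp add: cx_concd chm_concm dsum_concd msum_concm conc0_eq algebra_simps)
qed

text \<open>As \<open>f = f * e\<close>, the map factors through the free module containing the
  source, whose rank is known from normalization.\<close>

lemma rho_conc0_bound:
  assumes "pobj e" "pobj e'" "pmor e e' f"
  shows "rho (conc0 e) (conc0 e') (conc0m f) m \<le> real (dim_row e) * rconst d 1 m"
proof -
  let ?I = "1\<^sub>m (dim_row e) :: 'a mat"
  note d = pobjD[OF assms(1)] pobjD[OF assms(2)] pmorD[OF assms(3)] pmor_absorb[OF assms(3,1,2)]
  have p: "pobj ?I" "pmor e ?I e" "pmor ?I e' f" by (auto intro!: pobjI pmorI simp: d)
  have "rho (concd 0 e) (concd 0 e') (comp (concm 0 f) (concm 0 e)) m \<le> rho (concd 0 e) (concd 0 ?I) (concm 0 e) m"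
    by (rule rho_comp) (use assms p in \<open>auto intro: cx_concd chm_concm\<close>)
  also have "\<dots> \<le> rho (concd 0 ?I) (concd 0 ?I) (idc (concd 0 ?I)) m"
    by (rule rho_le_id) (use assms p in \<open>auto intro: cx_concd chm_concm\<close>)
  finally show ?thesis using rho_free[of "dim_row e" m] d by (simp add: conc0_eq comp_concm idc_concd)
qed

text \<open>The bound by a multiple of the constant 1, together with nonnegativity, kills every
  coefficient outside the support of that constant; periodicity makes the remaining ones
  equal.\<close>

lemma rho_conc0:
  assumes "pobj e" "pobj e'" "pmor e e' f"
  shows "rho (conc0 e) (conc0 e') (conc0m f) = rconst d (rho (conc0 e) (conc0 e') (conc0m f) 0)"
proof
  fix m
  let ?p = "rho (conc0 e) (conc0 e') (conc0m f)"
  have R: "Rpos d ?p" unfolding conc0_eq by (intro rho_Rpos cx_concd chm_concm assms)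
  then have z: "?p m = 0" if "rconst d 1 m = 0"
    using rho_conc0_bound[OF assms, of m] that by (simp add: Rpos_def antisym)
  show "?p m = rconst d (?p 0) m"
  proof (cases d)
    case (enat k)
    with R have per: "?p (n + int k) = ?p n" for n by (auto simp: Rpos_def Rd_def)
    have "?p (j * int k) = ?p 0" for j
    proof (induction j rule: int_induct[where k = 0])
      case (step1 i)
      then show ?case using per[of "i * int k"] by (simp add: algebra_simps)
    next
      case (step2 i)
      then show ?case using per[of "(i - 1) * int k"] by (simp add: algebra_simps)
    qed simp
    then show ?thesis using z enat by (auto simp: rconst_def dvd_def mult.commute)
  qed (use z in \<open>auto simp: rconst_def\<close>)
qed

text \<open>In degree 0, sums, triangular matrices and composites of chain maps are those of the
  matrices, so the axioms are read off from the coefficient of q^0.\<close>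

lemma sylvester_restriction: "sylvester (\<lambda>e e' f. rho (conc0 e) (conc0 e') (conc0m f) 0)"
  unfolding sylvester_def
proof (intro conjI allI impI; (elim conjE)?)
  show "rho (conc0 (1\<^sub>m 1)) (conc0 (1\<^sub>m 1)) (conc0m (1\<^sub>m 1)) 0 = 1"
    using rho_free[of 1 0] by (simp add: rconst_def split: enat.split)
next
  fix e e' f :: "'a mat" assume "pobj e" "pobj e'" "pmor e e' f"
  then show "0 \<le> rho (conc0 e) (conc0 e') (conc0m f) 0"
    unfolding conc0_eq by (intro rho_nonneg cx_concd chm_concm)
next
  fix e1 e2 e3 e4 f g h :: "'a mat"
  assume *: "pobj e1" "pobj e2" "pobj e3" "pobj e4" "pmor e1 e2 f" "pmor e3 e4 g"
  show "rho (conc0 (bdiag e1 e3)) (conc0 (bdiag e2 e4)) (conc0m (bdiag f g)) 0 =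
       rho (conc0 e1) (conc0 e2) (conc0m f) 0 + rho (conc0 e3) (conc0 e4) (conc0m g) 0"
    unfolding conc0_eq msum_concm[symmetric] dsum_concd[OF *(1,3), symmetric] dsum_concd[OF *(2,4), symmetric]
    by (intro rho_dsum cx_concd chm_concm *)
  assume h: "pmor e3 e2 h"
  show "rho (conc0 e1) (conc0 e2) (conc0m f) 0 + rho (conc0 e3) (conc0 e4) (conc0m g) 0
       \<le> rho (conc0 (bdiag e1 e3)) (conc0 (bdiag e2 e4)) (conc0m (utri f h g)) 0"
    unfolding conc0_eq msum_concm[symmetric] dsum_concd[OF *(1,3), symmetric] dsum_concd[OF *(2,4), symmetric]
    by (intro rho_mutri cx_concd chm_concm * h)
next
  fix e1 e2 e3 f g :: "'a mat"
  assume *: "pobj e1" "pobj e2" "pobj e3" "pmor e1 e2 f" "pmor e2 e3 g"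
  show "rho (conc0 e1) (conc0 e3) (conc0m (g * f)) 0 \<le> rho (conc0 e1) (conc0 e2) (conc0m f) 0"
    unfolding conc0_eq comp_concm[symmetric] by (intro rho_comp cx_concd chm_concm *)
  show "rho (conc0 e1) (conc0 e3) (conc0m (g * f)) 0 \<le> rho (conc0 e2) (conc0 e3) (conc0m g) 0"
    unfolding conc0_eq comp_concm[symmetric]
    by (rule rho_comp(2)) (use * in \<open>auto intro: cx_concd chm_concm\<close>)
qed

end

section \<open>Rotating cone triangles\<close>

text \<open>In degree \<open>i\<close> the cone of the inclusion of \<open>Y\<close> into
  \<open>cone X Y f\<close> is Y^(i+1) + X^(i+1) + Y^i. The map sends x to (- f x, x, 0); its first
  entry cancels the f x produced by the differential of the inner cone.\<close>

definition rot_in :: "'a::ring_1 cx \<Rightarrow> 'a cx \<Rightarrow> (int \<Rightarrow> 'a mat) \<Rightarrow> int \<Rightarrow> 'a mat" where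
  "rot_in X Y f = (\<lambda>i. (- f (i + 1)) @\<^sub>r (fst X (i + 1) @\<^sub>r 0\<^sub>m (dim_row (fst Y i)) (dim_row (fst X (i + 1)))))"

definition rot_out :: "'a::ring_1 cx \<Rightarrow> 'a cx \<Rightarrow> int \<Rightarrow> 'a mat" where
  "rot_out X Y = (\<lambda>i. 0\<^sub>m (dim_row (fst X (i + 1))) (dim_row (fst Y (i + 1))) @\<^sub>c
      (fst X (i + 1) @\<^sub>c 0\<^sub>m (dim_row (fst X (i + 1))) (dim_row (fst Y i))))"

text \<open>Sends (y, x, y') to (- y', 0, 0) one degree lower and thereby contracts the two copies
  of \<open>Y\<close> against each other.\<close>

definition rot_htp :: "'a::ring_1 cx \<Rightarrow> 'a cx \<Rightarrow> int \<Rightarrow> 'a mat" where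
  "rot_htp X Y = (\<lambda>i. four_block_mat (0\<^sub>m (dim_row (fst Y i)) (dim_row (fst Y (i + 1))))
      (0\<^sub>m (dim_row (fst Y i)) (dim_row (fst X (i + 1))) @\<^sub>c (- fst Y i))
      (0\<^sub>m (dim_row (fst X i) + dim_row (fst Y (i - 1))) (dim_row (fst Y (i + 1))))
      (0\<^sub>m (dim_row (fst X i) + dim_row (fst Y (i - 1))) (dim_row (fst X (i + 1)) + dim_row (fst Y i))))"

lemma append_cols_four_block:
  "dim_row A = n \<Longrightarrow> dim_row D = m \<Longrightarrow> dim_row B = n \<Longrightarrow> dim_row C = m \<Longrightarrow> dim_col C = dim_col A \<Longrightarrow> dim_col B = dim_col D \<Longrightarrow>
    0\<^sub>m (n + m) k @\<^sub>c four_block_mat A B C D = four_block_mat (0\<^sub>m n k) (A @\<^sub>c B) (0\<^sub>m m k) (C @\<^sub>c D)"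
  by (auto simp: append_cols_def intro!: eq_matI)

lemma snd_cone_pred: "snd (cone X Y f) (i - 1) = four_block_mat (- snd X i)
    (0\<^sub>m (dim_row (fst X (i + 1))) (dim_row (fst Y (i - 1)))) (f i) (snd Y (i - 1))"
  by (simp add: cone_def add.commute)

context
  fixes X Y :: "'a::ring_1 cx" and f
  assumes X: "cx X" and Y: "cx Y" and f: "chm X Y f"
begin

lemmas rot_facts = cxD[OF X] cxD[OF Y] cxD[OF X, of "_ + 1"] cxD[OF Y, of "_ + 1"] cx_prevD[OF X] cx_prevD[OF Y]
  chmD[OF f] chm_absorb[OF X Y f] chmD(2)[OF f, of "_ + 1"]

lemmas rot_simps = rot_in_def rot_out_def rot_htp_def cinc_eq cproj_eq[OF X] cproj_eq[OF Y]
  cone_def shiftc_def block_simps append_cols_four_block add.assoc comp_def idc_def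

lemma chm_rot_in: "chm (shiftc X) (cone Y (cone X Y f) (cinc X Y)) (rot_in X Y f)"
  by (rule chmI) (use rot_facts in \<open>auto simp: rot_simps\<close>)

lemma chm_rot_out: "chm (cone Y (cone X Y f) (cinc X Y)) (shiftc X) (rot_out X Y)"
  by (rule chmI) (use rot_facts in \<open>auto simp: rot_simps\<close>)

lemma rot_out_in: "comp (rot_out X Y) (rot_in X Y f) = idc (shiftc X)"
  by (rule ext) (use rot_facts in \<open>auto simp: rot_simps\<close>)

lemma rot_in_out: "htp (cone Y (cone X Y f) (cinc X Y)) (cone Y (cone X Y f) (cinc X Y))
    (comp (rot_in X Y f) (rot_out X Y)) (idc (cone Y (cone X Y f) (cinc X Y)))"
  unfolding htp_def
proof (intro exI conjI allI)
  fix i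
  show "pmor (fst (cone Y (cone X Y f) (cinc X Y)) i) (fst (cone Y (cone X Y f) (cinc X Y)) (i - 1)) (rot_htp X Y i)"
    by (rule pmorI) (use rot_facts in \<open>auto simp: rot_simps\<close>)
  show "comp (rot_in X Y f) (rot_out X Y) i - idc (cone Y (cone X Y f) (cinc X Y)) i =
       snd (cone Y (cone X Y f) (cinc X Y)) (i - 1) * rot_htp X Y i +
       rot_htp X Y (i + 1) * snd (cone Y (cone X Y f) (cinc X Y)) i"
    unfolding snd_cone_pred using rot_facts by (auto simp: rot_simps)
qed

text \<open>Under the equivalence with \<open>shiftc X\<close>, the inclusion into the iterated cone
  becomes the third map of the original triangle. The map after it becomes minus the shift of
  \<open>f\<close>.\<close>

lemma rot_out_cinc: "comp (rot_out X Y) (cinc Y (cone X Y f)) = cproj X Y"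
  by (rule ext) (use rot_facts in \<open>auto simp: rot_simps\<close>)

lemma cproj_rot_in: "comp (cproj Y (cone X Y f)) (rot_in X Y f) = (\<lambda>i. - shiftm f i)"
  by (rule ext) (use rot_facts in \<open>auto simp: rot_simps shiftm_def\<close>)

end

section \<open>Law of nullity and ranks along rotated triangles\<close>

lemma chm_uminus:
  assumes "cx X" "cx Y" "chm X Y f"
  shows "chm X Y (\<lambda>i. - f i)"
  by (rule chmI) (use cxD[OF assms(1)] cxD[OF assms(2)] chmD[OF assms(3)] chm_absorb[OF assms] in auto)

lemma chm_four_block:
  assumes "cx X" "cx Y" "cx Z" "cx W" "chm X Y f" "chm Z Y h" "chm X W k" "chm Z W g"
  shows "chm (dsum X Z) (dsum Y W) (\<lambda>i. four_block_mat (f i) (h i) (k i) (g i))"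
  by (rule chmI) (use cxD[OF assms(1)] cxD[OF assms(2)] cxD[OF assms(3)] cxD[OF assms(4)]
      chmD[OF assms(5)] chmD[OF assms(6)] chmD[OF assms(7)] chmD[OF assms(8)]
      chm_absorb[OF assms(1,2,5)] chm_absorb[OF assms(3,2,6)] chm_absorb[OF assms(1,4,7)] chm_absorb[OF assms(3,4,8)]
      in \<open>auto simp: dsum_def block_simps\<close>)

lemma chm_0:
  assumes "cx X" "cx Y"
  shows "chm X Y (\<lambda>i. 0\<^sub>m (dim_row (fst Y i)) (dim_row (fst X i)))"
  by (rule chmI) (use cxD[OF assms(1)] cxD[OF assms(2)] in auto)

context rank_function
begin

text \<open>Composition with minus the identity, applied twice. It removes the sign that rotation
  puts in front of the shift of \<open>f\<close>.\<close>

lemma rho_uminus: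
  assumes "cx X" "cx Y" "chm X Y f"
  shows "rho X Y (\<lambda>i. - f i) n = rho X Y f n"
proof -
  have *: "rho X Y (\<lambda>i. - f i) n \<le> rho X Y f n" if f: "chm X Y f" for f
  proof -
    have "comp (\<lambda>i. - idc Y i) f = (\<lambda>i. - f i)"
      using chm_absorb[OF assms(1,2) f] chmD[OF f] cxD[OF assms(2)] by (auto simp: comp_def idc_def)
    then show ?thesis
      using rho_comp(1)[OF assms(1,2,2) f chm_uminus[OF assms(2,2) chm_idc[OF assms(2)]], of n] by simp
  qed
  from *[OF assms(3)] *[OF chm_uminus[OF assms]] show ?thesis by simp
qed

text \<open>The triangular matrix with diagonal \<open>f\<close>, \<open>g\<close> and corner the
  identity of \<open>Y\<close> has rank at least the left side. Elimination with that corner turns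
  it into the direct sum of \<open>g f\<close> and the identity of \<open>Y\<close>.\<close>

lemma rho_nullity:
  assumes X: "cx X" and Y: "cx Y" and Z: "cx Z" and f: "chm X Y f" and g: "chm Y Z g"
  shows "rho X Y f n + rho Y Z g n \<le> rho X Z (comp g f) n + rho Y Y (idc Y) n"
proof -
  let ?O = "\<lambda>X Y i. 0\<^sub>m (dim_row (fst Y i)) (dim_row (fst X i)) :: 'a mat"
  define S where "S = (\<lambda>i. four_block_mat (- idc X i) (?O Y X i) (f i) (idc Y i))"
  define T where "T = msum (comp g f) (idc Y)"
  define R where "R = (\<lambda>i. four_block_mat (?O Z Y i) (idc Y i) (idc Z i) (g i))"
  have gf: "chm X Z (comp g f)" by (rule chm_comp) fact+
  note i = chm_idc[OF X] chm_idc[OF Y] chm_idc[OF Z]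
  have S: "chm (dsum X Y) (dsum X Y) S"
    unfolding S_def by (intro chm_four_block chm_0 X Y f i chm_uminus)
  have R: "chm (dsum Z Y) (dsum Y Z) R"
    unfolding R_def by (intro chm_four_block chm_0 Z Y g i)
  have "T = (\<lambda>i. four_block_mat (comp g f i) (?O Y Z i) (?O X Y i) (idc Y i))"
    using chmD[OF gf] cxD[OF Y] by (auto simp: T_def msum_def bdiag_def idc_def)
  then have T: "chm (dsum X Y) (dsum Z Y) T"
    by (simp only:) (intro chm_four_block chm_0 X Y Z i gf)
  have "mutri f (idc Y) g = comp R (comp T S)"
  proof
    fix j
    note d = cxD[OF X] cxD[OF Y] cxD[OF Z] chmD[OF f] chmD[OF g] chm_absorb[OF X Y f] chm_absorb[OF Y Z g]
      chm_absorb(1)[OF X Z gf, unfolded comp_def]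
    show "mutri f (idc Y) g j = comp R (comp T S) j"
      using d by (auto simp: mutri_def R_def T_def S_def comp_def msum_def idc_def block_simps)
  qed
  then have "rho X Y f n + rho Y Z g n \<le> rho (dsum X Y) (dsum Y Z) (comp R (comp T S)) n"
    using rho_mutri[OF X Y Y Z f g chm_idc[OF Y], of n] by simp
  also have "\<dots> \<le> rho (dsum X Y) (dsum Z Y) (comp T S) n"
    by (rule rho_comp(1)) (intro cx_dsum X Y Z chm_comp[OF _ _ _ S T] R)+
  also have "\<dots> \<le> rho (dsum X Y) (dsum Z Y) T n"
    by (rule rho_comp(2)) (intro cx_dsum X Y Z S T)+
  also have "\<dots> = rho X Z (comp g f) n + rho Y Y (idc Y) n"
    unfolding T_def by (intro rho_dsum X Y Z gf i)
  finally show ?thesis .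
qed

lemma kiso_rot_in:
  assumes "cx X" "cx Y" "chm X Y f"
  shows "kiso (shiftc X) (cone Y (cone X Y f) (cinc X Y)) (rot_in X Y f)"
  unfolding kiso_def
  using chm_rot_in[OF assms] chm_rot_out[OF assms] rot_out_in[OF assms] rot_in_out[OF assms]
  by (auto intro!: exI[of _ "rot_out X Y"] htp_refl cx_shiftc chm_idc assms)

text \<open>The cone triangle can be rotated because \<open>\<Sigma>X\<close> is homotopy equivalent to the cone of \<open>Y \<rightarrow> cone f\<close>.\<close>

lemma rho_cone:
  assumes X: "cx X" and Y: "cx Y" and f: "chm X Y f"
  shows "rho X Y f n + rho Y (cone X Y f) (cinc X Y) n = rho Y Y (idc Y) n"
    and "rho Y (cone X Y f) (cinc X Y) n + rho (cone X Y f) (shiftc X) (cproj X Y) n =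
      rho (cone X Y f) (cone X Y f) (idc (cone X Y f)) n"
    and "rho (cone X Y f) (shiftc X) (cproj X Y) n + rho X Y f (n - 1) = rho X X (idc X) (n - 1)"
proof -
  define C where "C = cone X Y f"
  define D where "D = cone Y C (cinc X Y)"
  define v where "v = rot_in X Y f"
  have C: "cx C" unfolding C_def by (intro cx_cone X Y f)
  have inc: "chm Y C (cinc X Y)" and proj: "chm C (shiftc X) (cproj X Y)"
    unfolding C_def using chm_cinc chm_cproj X Y f by blast+
  have D: "cx D" unfolding D_def by (intro cx_cone Y C inc)
  have S: "cx (shiftc X)" "cx (shiftc Y)" by (intro cx_shiftc X Y)+
  have v: "kiso (shiftc X) D v" unfolding D_def C_def v_def by (rule kiso_rot_in) fact+
  note v' = kisoD[OF v]
  have inc': "chm C D (cinc Y C)" and proj': "chm D (shiftc Y) (cproj Y C)"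
    unfolding D_def using chm_cinc chm_cproj Y C inc by blast+
  have u: "chm D (shiftc X) (rot_out X Y)" "comp (rot_out X Y) (cinc Y C) = cproj X Y"
    "htp D D (comp v (rot_out X Y)) (idc D)" "comp (cproj Y C) v = (\<lambda>i. - shiftm f i)"
    using chm_rot_out[OF X Y f] rot_out_cinc[OF X Y f] rot_in_out[OF X Y f] cproj_rot_in[OF X Y f]
    by (simp_all add: C_def D_def v_def)
  have sf: "chm (shiftc X) (shiftc Y) (\<lambda>i. - shiftm f i)"
    by (intro chm_uminus chm_shiftm S X Y f)
  have "htp C D (comp (comp v (rot_out X Y)) (cinc Y C)) (comp (idc D) (cinc Y C))"
    by (rule htp_comp_right[OF C D D inc' chm_comp[OF D S(1) D u(1) v'] chm_idc[OF D] u(3)])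
  then have sq1: "htp C D (comp v (cproj X Y)) (comp (cinc Y C) (idc C))"
    by (simp add: comp_assoc[OF inc' u(1) v'] u(2) comp_idc[OF C D inc'])
  have sq2: "htp (shiftc X) (shiftc Y) (comp (idc (shiftc Y)) (\<lambda>i. - shiftm f i)) (comp (cproj Y C) v)"
    using comp_idc[OF S sf] htp_refl[OF S sf] u(4) by simp
  have r1: "rho C (shiftc X) (cproj X Y) n = rho C D (cinc Y C) n"
    by (rule R_iso[OF C S(1) C D proj inc' kiso_idc[OF C] v sq1])
  have r2: "rho (shiftc X) (shiftc Y) (\<lambda>i. - shiftm f i) n = rho D (shiftc Y) (cproj Y C) n"
    by (rule R_iso[OF S D S(2) sf proj' v kiso_idc[OF S(2)] sq2])
  have r3: "rho (shiftc X) (shiftc X) (idc (shiftc X)) n = rho D D (idc D) n"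
    by (rule R_iso_id[OF S(1) D v])
  have tri: "rho X Y f n + rho Y C (cinc X Y) n = rho Y Y (idc Y) n"
    unfolding C_def by (rule rho_dtri[OF dtri_cone[OF X Y f]])
  have tri2: "rho Y C (cinc X Y) n + rho C (shiftc X) (cproj X Y) n = rho C C (idc C) n"
    unfolding r1 D_def by (rule rho_dtri[OF dtri_cone[OF Y C inc]])
  have tri3: "rho C D (cinc Y C) n + rho D (cone C D (cinc Y C)) (cinc C D) n = rho D D (idc D) n"
    by (rule rho_dtri[OF dtri_cone[OF C D inc']])
  \<comment> \<open>A second rotation: \<open>E\<close> is equivalent to the shift of
    \<open>Y\<close>, and the inclusion of \<open>D\<close> into it corresponds to
    \<open>cproj Y C\<close>, that is, to minus the shift of \<open>f\<close>.\<close>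
  have sub: "rho C D (cinc Y C) n + rho D (shiftc Y) (cproj Y C) n = rho D D (idc D) n"
  proof -
    define E where "E = cone C D (cinc Y C)"
    define w where "w = rot_in Y C (cinc X Y)"
    have E: "cx E" unfolding E_def by (intro cx_cone C D inc')
    have w: "kiso (shiftc Y) E w" unfolding E_def D_def w_def by (rule kiso_rot_in) fact+
    have incE: "chm D E (cinc C D)" unfolding E_def by (rule chm_cinc) fact+
    have t: "chm E (shiftc Y) (rot_out Y C)" "comp (rot_out Y C) (cinc C D) = cproj Y C"
      "htp E E (comp w (rot_out Y C)) (idc E)"
      using chm_rot_out[OF Y C inc] rot_out_cinc[OF Y C inc] rot_in_out[OF Y C inc]
      by (simp_all add: E_def D_def w_def)
    have "htp D E (comp (comp w (rot_out Y C)) (cinc C D)) (comp (idc E) (cinc C D))"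
      by (rule htp_comp_right[OF D E E incE chm_comp[OF E S(2) E t(1) kisoD[OF w]] chm_idc[OF E] t(3)])
    then have "htp D E (comp w (cproj Y C)) (comp (cinc C D) (idc D))"
      by (simp add: comp_assoc[OF incE t(1) kisoD[OF w]] t(2) comp_idc[OF D E incE])
    from R_iso[OF D S(2) D E proj' incE kiso_idc[OF D] w this] tri3 show ?thesis by (simp add: E_def)
  qed
  have sh: "rho (shiftc X) (shiftc Y) (\<lambda>i. - shiftm f i) n = rho X Y f (n - 1)"
    using rho_uminus[OF S chm_shiftm[OF X Y f], of n] rho_shift[OF X Y f, of n] by simp
  have shi: "rho (shiftc X) (shiftc X) (idc (shiftc X)) n = rho X X (idc X) (n - 1)"
    using rho_shift[OF X X chm_idc[OF X], of n] by (simp add: shiftm_idc)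
  show "rho X Y f n + rho Y (cone X Y f) (cinc X Y) n = rho Y Y (idc Y) n"
    "rho Y (cone X Y f) (cinc X Y) n + rho (cone X Y f) (shiftc X) (cproj X Y) n =
      rho (cone X Y f) (cone X Y f) (idc (cone X Y f)) n"
    using tri tri2 by (simp_all add: C_def)
  show "rho (cone X Y f) (shiftc X) (cproj X Y) n + rho X Y f (n - 1) = rho X X (idc X) (n - 1)"
    using sub r1 r2 r3 sh shi by (simp add: C_def)
qed

text \<open>Lowering the degree by one is the shift, which multiplies by q; the induction runs in
  both directions from degree 0.\<close>

lemma rho_concd:
  assumes "pobj e" "pobj e'" "pmor e e' f"
  shows "rho (concd k e) (concd k e') (concm k f) n = rho (conc0 e) (conc0 e') (conc0m f) (n + k)"
proof -
  have step: "rho (concd (k - 1) e) (concd (k - 1) e') (concm (k - 1) f) n =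
     rho (concd k e) (concd k e') (concm k f) (n - 1)" for k n
    using rho_shift[OF cx_concd[OF assms(1)] cx_concd[OF assms(2)] chm_concm[OF assms], of k n]
    by (simp add: shift_concd)
  show ?thesis
  proof (induction k arbitrary: n rule: int_induct[where k = 0])
    case (step1 i)
    then show ?case using step[of "i + 1" "n + 1"] by (simp add: algebra_simps)
  next
    case (step2 i)
    then show ?case using step[of i n] by (simp add: algebra_simps)
  qed (simp add: conc0_eq)
qed

end

section \<open>Brutal truncations and uniqueness\<close>

text \<open>The differential out of degree \<open>a - 1\<close> has no columns but must still have
  as many rows as its target, the term in degree \<open>a\<close>.\<close>

definition trunc :: "int \<Rightarrow> 'a::ring_1 cx \<Rightarrow> 'a cx" where
  "trunc a X = (\<lambda>i. if a \<le> i then fst X i else 0\<^sub>m 0 0,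
     \<lambda>i. if a \<le> i then snd X i else 0\<^sub>m (if i = a - 1 then dim_row (fst X a) else 0) 0)"

text \<open>The source is the module \<open>fst X a\<close> placed in degree \<open>a + 1\<close>,
  because forming the cone moves it down to degree \<open>a\<close>.\<close>

definition attach :: "int \<Rightarrow> 'a::ring_1 cx \<Rightarrow> int \<Rightarrow> 'a mat" where
  "attach a X = (\<lambda>i. if i = a + 1 then snd X a else 0\<^sub>m (dim_row (fst (trunc (a + 1) X) i)) 0)"

lemma cx_trunc:
  assumes "cx X"
  shows "cx (trunc a X)"
proof -
  note d = cxD[OF assms]
  have fin: "finite {i. dim_row (fst (trunc a X) i) \<noteq> 0}"
    by (rule finite_subset[OF _ cx_finite[OF assms]]) (auto simp: trunc_def)
  have z: "pobj (0\<^sub>m 0 0 :: 'a mat)" by (auto intro: pobjI)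
  show ?thesis unfolding cx_def
  proof (intro conjI allI fin)
    fix i
    show "pobj (fst (trunc a X) i)" using d z by (simp add: trunc_def)
    consider "i < a - 1" | "i = a - 1" | "a \<le> i" by linarith
    then show "pmor (fst (trunc a X) i) (fst (trunc a X) (i + 1)) (snd (trunc a X) i)"
      by cases (rule pmorI; use d in \<open>auto simp: trunc_def\<close>)+
    show "snd (trunc a X) (i + 1) * snd (trunc a X) i =
         0\<^sub>m (dim_row (fst (trunc a X) (i + 2))) (dim_row (fst (trunc a X) i))"
      using d(3)[of i] d(5)[of "i + 1"] d(6)[of "i + 1"] d(6)[of i] by (auto simp: trunc_def add.assoc add.commute[of 2 i])
  qed
qed

lemma chm_attach:
  assumes "cx X"
  shows "chm (concd (a + 1) (fst X a)) (trunc (a + 1) X) (attach a X)"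
proof (rule chmI)
  note d = cxD[OF assms] cxD[OF cx_trunc[OF assms]]
  fix i
  show "dim_row (attach a X i) = dim_row (fst (trunc (a + 1) X) i)"
    "dim_col (attach a X i) = dim_row (fst (concd (a + 1) (fst X a)) i)"
    "fst (trunc (a + 1) X) i * attach a X i = attach a X i"
    "attach a X i * fst (concd (a + 1) (fst X a)) i = attach a X i"
    using d by (auto simp: attach_def concd_def trunc_def)
  show "snd (trunc (a + 1) X) i * attach a X i = attach a X (i + 1) * snd (concd (a + 1) (fst X a)) i"
  proof (cases "i = a + 1")
    case True
    then show ?thesis using d(3)[of a] d(6)[of "a + 1"] by (simp add: attach_def concd_def trunc_def add.assoc)
  next
    case False
    then show ?thesis using d by (auto simp: attach_def concd_def trunc_def)
  qed
qed

text \<open>Holds as an equality of complexes, so no comparison isomorphism is needed. No sign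
  appears, since the one-term source has zero differential.\<close>

lemma cone_attach:
  assumes "cx X"
  shows "cone (concd (a + 1) (fst X a)) (trunc (a + 1) X) (attach a X) = trunc a X"
proof (rule prod_eqI)
  note d = cxD[OF assms]
  show "fst (cone (concd (a + 1) (fst X a)) (trunc (a + 1) X) (attach a X)) = fst (trunc a X)"
  proof
    fix i
    consider "i < a" | "i = a" | "a < i" by linarith
    then show "fst (cone (concd (a + 1) (fst X a)) (trunc (a + 1) X) (attach a X)) i = fst (trunc a X) i"
      by cases (use d in \<open>auto simp: cone_def concd_def trunc_def bdiag_def degenerate_four_block\<close>)
  qed
  show "snd (cone (concd (a + 1) (fst X a)) (trunc (a + 1) X) (attach a X)) = snd (trunc a X)"
  proof
    fix i
    consider "i < a - 1" | "i = a - 1" | "i = a" | "a < i" by linarith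
    then show "snd (cone (concd (a + 1) (fst X a)) (trunc (a + 1) X) (attach a X)) i = snd (trunc a X) i"
      by cases (use d in \<open>auto simp: cone_def concd_def trunc_def attach_def degenerate_four_block\<close>)
  qed
qed

lemma cproj_attach:
  assumes "cx X"
  shows "comp (cproj (concd (a + 2) (fst X (a + 1))) (trunc (a + 2) X)) (attach a X) = concm (a + 1) (snd X a)"
proof
  fix i
  note d = cxD[OF assms]
  have "fst X (a + 1) @\<^sub>c 0\<^sub>m (dim_row (fst X (a + 1))) 0 = fst X (a + 1)"
    using d by (auto simp: append_cols_def degenerate_four_block)
  then show "comp (cproj (concd (a + 2) (fst X (a + 1))) (trunc (a + 2) X)) (attach a X) i = concm (a + 1) (snd X a) i"
    unfolding comp_def cproj_eq[OF cx_concd[OF d(1)]]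
    using d by (auto simp: attach_def concd_def trunc_def concm_def)
qed

lemma trunc_eq_self:
  assumes "cx X" "\<And>i. i < a \<Longrightarrow> dim_row (fst X i) = 0"
  shows "trunc a X = X"
proof (rule prod_eqI)
  note d = cxD[OF assms(1)]
  show "fst (trunc a X) = fst X"
    by (rule ext) (use d assms in \<open>auto simp: trunc_def intro!: eq_matI\<close>)
  have "i < a \<Longrightarrow> i \<noteq> a - 1 \<Longrightarrow> dim_row (fst X (i + 1)) = 0" for i using assms(2)[of "i + 1"] by simp
  then show "snd (trunc a X) = snd X"
    by (intro ext) (use d assms in \<open>auto simp: trunc_def intro!: eq_matI\<close>)
qed

lemma trunc_eq_0:
  assumes "cx X" "\<And>i. a \<le> i \<Longrightarrow> dim_row (fst X i) = 0"
  shows "trunc a X = concd 0 (0\<^sub>m 0 0)"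
proof (rule prod_eqI)
  note d = cxD[OF assms(1)]
  show "fst (trunc a X) = fst (concd 0 (0\<^sub>m 0 0))"
    by (rule ext) (use d assms in \<open>auto simp: trunc_def concd_def intro!: eq_matI\<close>)
  show "snd (trunc a X) = snd (concd 0 (0\<^sub>m 0 0))"
    by (rule ext) (use d assms in \<open>auto simp: trunc_def concd_def intro!: eq_matI\<close>)
qed

text \<open>Descending induction: beyond the finite support the truncation is the zero
  complex.\<close>

lemma trunc_induct [consumes 1, case_names zero step]:
  assumes X: "cx X" and zero: "\<And>a. trunc a X = concd 0 (0\<^sub>m 0 0) \<Longrightarrow> P a"
    and step: "\<And>a. P (a + 1) \<Longrightarrow> P a"
  shows "P a"
proof -
  obtain N where N: "\<And>i. dim_row (fst X i) \<noteq> 0 \<Longrightarrow> \<bar>i\<bar> \<le> N"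
    using finite_int_iff_bounded_le[of "{i. dim_row (fst X i) \<noteq> 0}"] cx_finite[OF X] by (auto simp: image_subset_iff)
  have "P b" if "N < b" for b by (rule zero, rule trunc_eq_0[OF X]) (use N that in fastforce)
  moreover have "P b" if "b \<le> N + 1" for b
    using that
  proof (induction b rule: int_le_induct)
    case base
    show ?case by (rule calculation) simp
  next
    case (step i)
    then show ?case using assms(3)[of "i - 1"] by simp
  qed
  ultimately show ?thesis by (cases "a \<le> N + 1") auto
qed

section \<open>Degree bounds and attaching maps for Laurent polynomial ranks\<close>

locale laurent_rank_function = normalized_rank_function \<infinity> rho for rho :: "'a::ring_1 cx \<Rightarrow> 'a cx \<Rightarrow> (int \<Rightarrow> 'a mat) \<Rightarrow> int \<Rightarrow> real"
begin

lemma rho_concd_support: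
  assumes "pobj e" "n \<noteq> - k"
  shows "rho (concd k e) (concd k e) (idc (concd k e)) n = 0"
proof -
  have p: "pmor e e e" by (rule pmorI) (use pobjD[OF assms(1)] in auto)
  show ?thesis unfolding idc_concd rho_concd[OF assms(1,1) p]
    by (subst rho_conc0[OF assms(1,1) p]) (use assms(2) in \<open>simp add: rconst_def\<close>)
qed

text \<open>The rank of a cone is the sum of the ranks of its inclusion and projection. They are
  bounded by the higher truncation and by the shifted lowest term, and neither reaches a power above
  \<open>- a\<close>.\<close>

lemma rho_trunc_support:
  assumes "cx X"
  shows "- a < n \<Longrightarrow> rho (trunc a X) (trunc a X) (idc (trunc a X)) n = 0"
  using assms
proof (induction a rule: trunc_induct)
  case (zero a)
  then show ?case using rho_0[of 0 n] by (simp add: idc_concd)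
next
  case (step a)
  let ?S = "concd (a + 1) (fst X a)" and ?T = "trunc (a + 1) X"
  have c: "cx ?S" "cx ?T" "chm ?S ?T (attach a X)"
    using assms by (auto intro: cx_concd cx_trunc chm_attach cxD(1))
  note C = cone_attach[OF assms, of a]
  have "rho ?T (trunc a X) (cinc ?S ?T) n \<le> rho ?T ?T (idc ?T) n"
    by (rule rho_le_id) (use c cx_trunc[OF assms] chm_cinc[OF c] C in auto)
  moreover have "rho (trunc a X) (shiftc ?S) (cproj ?S ?T) n \<le> rho ?S ?S (idc ?S) (n - 1)"
    using rho_cone(3)[OF c, of n] rho_nonneg[OF c, of "n - 1"] C by simp
  moreover have "rho ?S ?S (idc ?S) (n - 1) = 0"
    by (rule rho_concd_support) (use step cxD[OF assms] in auto)
  moreover have "rho ?T ?T (idc ?T) n = 0" using step by simp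
  moreover have "0 \<le> rho (trunc a X) (trunc a X) (idc (trunc a X)) n"
    using cx_trunc[OF assms] by (intro rho_nonneg chm_idc)
  ultimately show ?case using rho_cone(2)[OF c, of n] C by simp
qed

text \<open>The attaching map composed with the projection onto the lowest term is the differential.
  The projection loses only what comes from \<open>trunc (a + 2) X\<close>, which has no rank in this degree.\<close>

lemma rho_attach:
  assumes X: "cx X"
  shows "rho (concd (a + 1) (fst X a)) (trunc (a + 1) X) (attach a X) n =
    (if n = - (a + 1) then rho (conc0 (fst X a)) (conc0 (fst X (a + 1))) (conc0m (snd X a)) 0 else 0)"
proof (cases "n = - (a + 1)")
  case False
  have c: "cx (concd (a + 1) (fst X a))" "cx (trunc (a + 1) X)"
    "chm (concd (a + 1) (fst X a)) (trunc (a + 1) X) (attach a X)"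
    using X by (auto intro: cx_concd cx_trunc chm_attach cxD(1))
  have "rho (concd (a + 1) (fst X a)) (concd (a + 1) (fst X a)) (idc (concd (a + 1) (fst X a))) n = 0"
    by (rule rho_concd_support) (use False cxD[OF X] in auto)
  with rho_le_id(1)[OF c, of n] rho_nonneg[OF c, of n] False show ?thesis by simp
next
  case True
  let ?S = "concd (a + 1) (fst X a)" and ?T = "trunc (a + 1) X"
    and ?S' = "concd (a + 2) (fst X (a + 1))" and ?T' = "trunc (a + 2) X"
  have c: "cx ?S" "cx ?T" "chm ?S ?T (attach a X)" and c': "cx ?S'" "cx ?T'" "chm ?S' ?T' (attach (a + 1) X)"
    using X chm_attach[OF X, of "a + 1"] by (auto intro: cx_concd cx_trunc chm_attach cxD(1) simp: add.assoc)
  \<comment> \<open>The target of the attaching map is itself a cone, which supplies the projection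
    onto its lowest term.\<close>
  have C: "cone ?S' ?T' (attach (a + 1) X) = ?T"
    using cone_attach[OF X, of "a + 1"] by (simp add: add.assoc)
  have S': "cx (shiftc ?S')" by (rule cx_shiftc) fact
  have p: "chm ?T (shiftc ?S') (cproj ?S' ?T')" using chm_cproj[OF c'] C by simp
  have "rho ?S (shiftc ?S') (comp (cproj ?S' ?T') (attach a X)) n =
      rho (conc0 (fst X a)) (conc0 (fst X (a + 1))) (conc0m (snd X a)) 0"
    using rho_concd[of "fst X a" "fst X (a + 1)" "snd X a" "a + 1" n] cxD[OF X] True
    by (simp add: cproj_attach[OF X] shift_concd add.commute[of 1 a])
  moreover have "rho ?S (shiftc ?S') (comp (cproj ?S' ?T') (attach a X)) n \<le> rho ?S ?T (attach a X) n"
    by (rule rho_comp(1)[OF c(1,2) S' c(3) p])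
  \<comment> \<open>Nullity bounds the attaching map by the differential plus what the projection
    loses. By the next equation that loss is the rank of the inclusion of \<open>?T'\<close>, which
    lives in powers up to \<open>- (a + 2)\<close>, just below \<open>n\<close>.\<close>
  moreover have "rho ?S ?T (attach a X) n + rho ?T (shiftc ?S') (cproj ?S' ?T') n
      \<le> rho ?S (shiftc ?S') (comp (cproj ?S' ?T') (attach a X)) n + rho ?T ?T (idc ?T) n"
    by (rule rho_nullity[OF c(1,2) S' c(3) p])
  moreover have "rho ?T' ?T (cinc ?S' ?T') n + rho ?T (shiftc ?S') (cproj ?S' ?T') n = rho ?T ?T (idc ?T) n"
    using rho_cone(2)[OF c', of n] C by simp
  moreover have "rho ?T' ?T (cinc ?S' ?T') n \<le> rho ?T' ?T' (idc ?T') n"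
    by (rule rho_le_id) (use c c' chm_cinc[OF c'] C in auto)
  moreover have "rho ?T' ?T' (idc ?T') n = 0" by (rule rho_trunc_support[OF X]) (use True in simp)
  ultimately show ?thesis using True by simp
qed

end

lemma laurent_rank_functions_eq:
  assumes "laurent_rank_function rho1" "laurent_rank_function rho2"
    and eq: "\<And>e e' f. pobj e \<Longrightarrow> pobj e' \<Longrightarrow> pmor e e' f \<Longrightarrow>
      rho1 (conc0 e) (conc0 e') (conc0m f) = rho2 (conc0 e) (conc0 e') (conc0m f)"
    and "cx X" "cx Y" "chm X Y g"
  shows "rho1 X Y g = rho2 X Y g"
proof -
  interpret r1: laurent_rank_function rho1 by fact
  interpret r2: laurent_rank_function rho2 by fact
  have id: "rho1 (trunc a X) (trunc a X) (idc (trunc a X)) = rho2 (trunc a X) (trunc a X) (idc (trunc a X))"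
    if X: "cx X" for a X
    using X
  proof (induction a rule: trunc_induct)
    case (zero a)
    then show ?case using r1.rho_0[of 0] r2.rho_0[of 0] by (simp add: idc_concd fun_eq_iff)
  next
    case (step a)
    let ?S = "concd (a + 1) (fst X a)" and ?T = "trunc (a + 1) X"
    have c: "cx ?S" "cx ?T" "chm ?S ?T (attach a X)"
      using X by (auto intro: cx_concd cx_trunc chm_attach cxD(1))
    have "pmor (fst X a) (fst X a) (fst X a)" by (rule pmorI) (use cxD[OF X] in auto)
    then have S: "rho1 ?S ?S (idc ?S) n = rho2 ?S ?S (idc ?S) n" for n
      using r1.rho_concd r2.rho_concd eq cxD[OF X] by (simp add: idc_concd)
    have "rho1 (conc0 (fst X a)) (conc0 (fst X (a + 1))) (conc0m (snd X a)) =
        rho2 (conc0 (fst X a)) (conc0 (fst X (a + 1))) (conc0m (snd X a))"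
      by (rule eq) (use cxD[OF X] in auto)
    then have att: "rho1 ?S ?T (attach a X) n = rho2 ?S ?T (attach a X) n" for n
      by (simp add: r1.rho_attach[OF X] r2.rho_attach[OF X])
    show ?case
    proof
      fix n
      \<comment> \<open>The cone identities give the object as \<open>?T\<close> minus the attaching
        map, plus q times the lowest term minus the attaching map. All of these agree for the two
        functions.\<close>
      show "rho1 (trunc a X) (trunc a X) (idc (trunc a X)) n = rho2 (trunc a X) (trunc a X) (idc (trunc a X)) n"
        using r1.rho_cone[OF c, of n] r2.rho_cone[OF c, of n] S[of "n - 1"] att[of n] att[of "n - 1"] step.IH
        by (simp add: cone_attach[OF X])
    qed
  qed
  have obj: "rho1 X X (idc X) n = rho2 X X (idc X) n" if X: "cx X" for X n
  proof -
    obtain N where N: "\<And>i. dim_row (fst X i) \<noteq> 0 \<Longrightarrow> \<bar>i\<bar> \<le> N"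
      using finite_int_iff_bounded_le[of "{i. dim_row (fst X i) \<noteq> 0}"] cx_finite[OF X] by (auto simp: image_subset_iff)
    have "trunc (- N) X = X" by (rule trunc_eq_self[OF X]) (use N in fastforce)
    with id[OF X, of "- N"] show ?thesis by simp
  qed
  note c = assms(4-6)
  define D where "D n = rho1 X Y g n - rho2 X Y g n" for n
  \<comment> \<open>This is (1 + q) D = 0, obtained by eliminating the inclusion and the projection
    from the cone identities.\<close>
  have alt: "D n = - D (n - 1)" for n
    using r1.rho_cone[OF c, of n] r2.rho_cone[OF c, of n] obj[OF c(1), of "n - 1"] obj[OF c(2), of n]
      obj[OF cx_cone[OF c], of n] by (simp add: D_def)
  have "finite {n. D n \<noteq> 0}"
    by (rule finite_subset[of _ "{n. rho1 X Y g n \<noteq> 0} \<union> {n. rho2 X Y g n \<noteq> 0}"])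
      (use r1.rho_Rpos[OF c] r2.rho_Rpos[OF c] in \<open>auto simp: D_def Rpos_def Rd_def\<close>)
  then obtain N where N: "\<And>n. D n \<noteq> 0 \<Longrightarrow> \<bar>n\<bar> \<le> N"
    using finite_int_iff_bounded_le[of "{n. D n \<noteq> 0}"] by (auto simp: image_subset_iff)
  have "D n = 0" for n
  proof -
    \<comment> \<open>The recursion starts just below the support and carries the zero upwards;
      smaller indices lie outside the support anyway.\<close>
    have "D (- \<bar>N\<bar> - 1 + int k) = 0" for k
    proof (induction k)
      case 0
      show ?case using N[of "- \<bar>N\<bar> - 1"] by fastforce
    next
      case (Suc k)
      then show ?case using alt[of "- \<bar>N\<bar> - 1 + int (Suc k)"] by (simp add: algebra_simps)
    qed
    from this[of "nat (n + \<bar>N\<bar> + 1)"] N[of n] show ?thesis by force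
  qed
  then show ?thesis by (auto simp: D_def)
qed

theorem theorem3p7:
  fixes d :: enat
  assumes "d \<noteq> 0"
  shows
   "(\<forall>rho :: 'a::ring_1 cx \<Rightarrow> 'a cx \<Rightarrow> (int \<Rightarrow> 'a mat) \<Rightarrow> int \<Rightarrow> real.
       rank_fn d rho \<and> normalized d rho \<longrightarrow>
       (\<exists>s. sylvester s \<and>
          (\<forall>e e' f. pobj e \<and> pobj e' \<and> pmor e e' f \<longrightarrow>
             rho (conc0 e) (conc0 e') (conc0m f) = rconst d (s e e' f)))) \<and>
    (d = \<infinity> \<longrightarrow>
      (\<forall>rho1 rho2 :: 'a cx \<Rightarrow> 'a cx \<Rightarrow> (int \<Rightarrow> 'a mat) \<Rightarrow> int \<Rightarrow> real.
         rank_fn \<infinity> rho1 \<and> normalized \<infinity> rho1 \<and> rank_fn \<infinity> rho2 \<and> normalized \<infinity> rho2 \<and>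
         (\<forall>e e' f. pobj e \<and> pobj e' \<and> pmor e e' f \<longrightarrow>
             rho1 (conc0 e) (conc0 e') (conc0m f) = rho2 (conc0 e) (conc0 e') (conc0m f)) \<longrightarrow>
         (\<forall>X Y g. cx X \<and> cx Y \<and> chm X Y g \<longrightarrow> rho1 X Y g = rho2 X Y g)) \<and>
      (\<forall>s :: 'a mat \<Rightarrow> 'a mat \<Rightarrow> 'a mat \<Rightarrow> real. sylvester s \<longrightarrow>
         (\<exists>rho :: 'a cx \<Rightarrow> 'a cx \<Rightarrow> (int \<Rightarrow> 'a mat) \<Rightarrow> int \<Rightarrow> real.
            rank_fn \<infinity> rho \<and> normalized \<infinity> rho \<and>
            (\<forall>e e' f. pobj e \<and> pobj e' \<and> pmor e e' f \<longrightarrow>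
               rho (conc0 e) (conc0 e') (conc0m f) = rconst \<infinity> (s e e' f)))))"
proof (intro conjI allI impI; (elim conjE)?)
  fix rho :: "'a cx \<Rightarrow> 'a cx \<Rightarrow> (int \<Rightarrow> 'a mat) \<Rightarrow> int \<Rightarrow> real"
  assume "rank_fn d rho" "normalized d rho"
  then interpret normalized_rank_function d rho by unfold_locales
  show "\<exists>s. sylvester s \<and> (\<forall>e e' f. pobj e \<and> pobj e' \<and> pmor e e' f \<longrightarrow>
      rho (conc0 e) (conc0 e') (conc0m f) = rconst d (s e e' f))"
    \<comment> \<open>The witness is the coefficient of q^0.\<close>
    using sylvester_restriction rho_conc0 by blast
next
  fix rho1 rho2 :: "'a cx \<Rightarrow> 'a cx \<Rightarrow> (int \<Rightarrow> 'a mat) \<Rightarrow> int \<Rightarrow> real"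
    and X Y :: "'a cx" and g
  assume "rank_fn \<infinity> rho1" "normalized \<infinity> rho1" "rank_fn \<infinity> rho2" "normalized \<infinity> rho2"
  then have "laurent_rank_function rho1" "laurent_rank_function rho2" by unfold_locales
  moreover assume "\<forall>e e' f. pobj e \<and> pobj e' \<and> pmor e e' f \<longrightarrow>
      rho1 (conc0 e) (conc0 e') (conc0m f) = rho2 (conc0 e) (conc0 e') (conc0m f)"
    and "cx X" "cx Y" "chm X Y g"
  ultimately show "rho1 X Y g = rho2 X Y g" using laurent_rank_functions_eq[of rho1 rho2 X Y g] by metis
next
  fix s :: "'a mat \<Rightarrow> 'a mat \<Rightarrow> 'a mat \<Rightarrow> real"
  assume "sylvester s"
  then show "\<exists>rho :: 'a cx \<Rightarrow> 'a cx \<Rightarrow> (int \<Rightarrow> 'a mat) \<Rightarrow> int \<Rightarrow> real. rank_fn \<infinity> rho \<and> normalized \<infinity> rho \<and>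
      (\<forall>e e' f. pobj e \<and> pobj e' \<and> pmor e e' f \<longrightarrow>
         rho (conc0 e) (conc0 e') (conc0m f) = rconst \<infinity> (s e e' f))"
    by (rule sylvester_extends)
qed

end
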